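(* Let $\mathcal H$ be a complex separable infinite dimensional Hilbert space. The $C^*$-algebras $\ell_\infty\otimes\mathcal B(\mathcal H)$ and $\ell_\infty(\mathbb N,\mathcal B(\mathcal H))$ are nonisomorphic even as Jordan algebras; that is, there is no bijective Jordan homomorphism between them.
   Context: $\mathcal B(\mathcal H)$ denotes the $C^*$-algebra of all bounded linear operators on $\mathcal H$. $\ell_\infty$ is the commutative $C^*$-algebra of all bounded complex sequences indexed by $\mathbb N$, and $\ell_\infty\otimes\mathcal B(\mathcal H)$ is the (completed) $C^*$-algebra tensor product (the $C^*$-norm on the algebraic tensor product is unique since $\ell_\infty$ is commutative). $\ell_\infty(\mathbb N,\mathcal B(\mathcal H))=\{(A_n)_n : A_n\in\mathcal B(\mathcal H)\ (n\in\mathbb N),\ \sup_n\|A_n\|<\infty\}$ is a $C^*$-algebra with coordinatewise operations and the supremum norm. If $\mathcal R$ and $\mathcal R'$ are algebras, a linear map $\phi:\mathcal R\to\mathcal R'$ is called a Jordan homomorphism if $\phi(A)^2=\phi(A^2)$ for every $A\in\mathcal R$. *)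

theory Defs
  imports "HOL-Analysis.Analysis" "HOL-Library.Poly_Mapping"
begin

section \<open>Complex vector spaces and Hilbert spaces\<close>

class scaleC =
  fixes scaleC :: "complex \<Rightarrow> 'a \<Rightarrow> 'a"  (infixr \<open>*\<^sub>C\<close> 75)

class complex_vector = real_vector + scaleC +
  assumes scaleC_add_right: "c *\<^sub>C (x + y) = c *\<^sub>C x + c *\<^sub>C y"
    and scaleC_add_left: "(c + d) *\<^sub>C x = c *\<^sub>C x + d *\<^sub>C x"
    and scaleC_scaleC: "c *\<^sub>C d *\<^sub>C x = (c * d) *\<^sub>C x"
    and scaleC_one: "1 *\<^sub>C x = x"
    and scaleR_scaleC: "r *\<^sub>R x = of_real r *\<^sub>C x"

global_interpretation complex_vector: vector_space "scaleC :: complex \<Rightarrow> 'a \<Rightarrow> 'a::complex_vector"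
  defines cspan = complex_vector.span
  by unfold_locales (simp_all add: scaleC_add_right scaleC_add_left scaleC_scaleC scaleC_one)

abbreviation clinear :: "('a::complex_vector \<Rightarrow> 'b::complex_vector) \<Rightarrow> bool"
  where "clinear \<equiv> Vector_Spaces.linear scaleC scaleC"

class complex_normed_vector = complex_vector + real_normed_vector +
  assumes norm_scaleC: "norm (c *\<^sub>C x) = cmod c * norm x"

class complex_hilbert_space = complex_normed_vector + banach +
  fixes cinner :: "'a \<Rightarrow> 'a \<Rightarrow> complex"
  assumes cinner_commute: "cinner x y = cnj (cinner y x)"
    and cinner_add_left: "cinner (x + y) z = cinner x z + cinner y z"
    and cinner_scaleC_left: "cinner (c *\<^sub>C x) y = c * cinner x y"
    and cinner_self: "cinner x x = of_real ((norm x)\<^sup>2)"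

lemma cinner_add_right: "cinner x (y + z) = cinner x y + cinner x z"
  by (metis cinner_add_left cinner_commute complex_cnj_add)

lemma cinner_scaleC_right: "cinner x (c *\<^sub>C y) = cnj c * cinner x y"
  by (metis cinner_commute cinner_scaleC_left complex_cnj_mult)

lemma cinner_zero_left [simp]: "cinner 0 y = 0"
  using cinner_add_left[of 0 0 y] by simp

lemma cinner_zero_right [simp]: "cinner y 0 = 0"
  using cinner_add_right[of y 0 0] by simp

lemma cinner_diff_left: "cinner (x - y) z = cinner x z - cinner y z"
  by (metis add_diff_cancel_right' cinner_add_left diff_add_cancel)

lemma cinner_diff_right: "cinner x (y - z) = cinner x y - cinner x z"
  by (metis add_diff_cancel_right' cinner_add_right diff_add_cancel)

lemma cinner_eqI:
  assumes "\<And>x. cinner x y = cinner x z"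
  shows "y = z"
proof -
  have "cinner (y - z) (y - z) = 0"
    using assms[of "y - z"] by (simp add: cinner_diff_right)
  then show ?thesis by (simp add: cinner_self)
qed

lemma norm_add_cinner: "(norm (x + y))\<^sup>2 = (norm x)\<^sup>2 + 2 * Re (cinner y x) + (norm y)\<^sup>2"
proof -
  have "complex_of_real ((norm (x + y))\<^sup>2) = cinner (x + y) (x + y)"
    by (simp only: cinner_self)
  also have "\<dots> = cinner x x + cnj (cinner y x) + cinner y x + cinner y y"
    using cinner_commute[of x y] by (simp add: cinner_add_left cinner_add_right)
  finally have "Re (complex_of_real ((norm (x + y))\<^sup>2))
      = Re (cinner x x + cnj (cinner y x) + cinner y x + cinner y y)" by (rule arg_cong)
  then show ?thesis by (simp only: cinner_self plus_complex.sel Re_complex_of_real cnj.sel)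
qed

lemma cinner_minimal:
  assumes min: "\<And>c. norm u \<le> norm (u + c *\<^sub>C v)"
  shows "cinner v u = 0"
proof (rule ccontr)
  assume nz: "cinner v u \<noteq> 0"
  define a where "a = cinner v u"
  define s where "s = 1 / ((norm v)\<^sup>2 + 1)"
  have s: "s > 0" "s * (norm v)\<^sup>2 < 1"
    by (auto simp: s_def divide_simps add_pos_nonneg add_nonneg_pos)
  have "(norm u)\<^sup>2 \<le> (norm (u + (- (s * cnj a)) *\<^sub>C v))\<^sup>2"
    by (intro power_mono min) simp
  also have "\<dots> = (norm u)\<^sup>2 - 2 * s * (cmod a)\<^sup>2 + s\<^sup>2 * (cmod a)\<^sup>2 * (norm v)\<^sup>2"
  proof -
    have "cinner ((- (s * cnj a)) *\<^sub>C v) u = - of_real (s * (cmod a)\<^sup>2)"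
      unfolding cinner_scaleC_left a_def[symmetric]
      by (simp add: complex_norm_square mult_ac del: of_real_power)
    then show ?thesis using s
      by (simp only: norm_add_cinner norm_scaleC)
        (simp add: norm_mult power_mult_distrib)
  qed
  finally have "0 \<le> s * (cmod a)\<^sup>2 * (s * (norm v)\<^sup>2 - 2)"
    by (simp add: algebra_simps power2_eq_square)
  moreover have "s * (cmod a)\<^sup>2 > 0" using s nz by (simp add: a_def)
  ultimately show False using s by (simp add: zero_le_mult_iff)
qed

lemma Cauchy_Schwarz_cinner: "cmod (cinner x y) \<le> norm x * norm y"
proof (cases "y = 0")
  case False
  define n where "n = (norm y)\<^sup>2"
  have n: "n > 0" using False by (simp add: n_def)
  define a where "a = cinner y x"
  have "0 \<le> (norm (x + (- (cnj a / n)) *\<^sub>C y))\<^sup>2" by simp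
  also have "\<dots> = (norm x)\<^sup>2 - 2 * ((cmod a)\<^sup>2 / n) + (cmod a)\<^sup>2 / n\<^sup>2 * n"
  proof -
    have "cinner ((- (cnj a / n)) *\<^sub>C y) x = - of_real ((cmod a)\<^sup>2 / n)"
      unfolding cinner_scaleC_left a_def[symmetric]
      by (simp add: complex_norm_square mult_ac del: of_real_power)
    then show ?thesis using n
      by (simp only: norm_add_cinner norm_scaleC)
        (simp add: norm_divide power_divide power_mult_distrib n_def norm_power)
  qed
  also have "\<dots> = (norm x)\<^sup>2 - (cmod a)\<^sup>2 / n"
    using n by (simp add: power2_eq_square)
  finally have "(cmod a)\<^sup>2 \<le> (norm x)\<^sup>2 * n" using n by (simp add: divide_simps)
  then have "(cmod a)\<^sup>2 \<le> (norm x * norm y)\<^sup>2" by (simp add: n_def power_mult_distrib)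
  then have "cmod a \<le> norm x * norm y" by (rule power2_le_imp_le) simp
  then show ?thesis using cinner_commute[of x y] by (simp add: a_def)
qed simp

lemma riesz_representation:
  fixes f :: "'a::complex_hilbert_space \<Rightarrow> complex"
  assumes add: "\<And>x y. f (x + y) = f x + f y"
    and scale: "\<And>c x. f (c *\<^sub>C x) = c * f x"
    and bdd: "\<And>x. cmod (f x) \<le> K * norm x"
  shows "\<exists>z. \<forall>x. f x = cinner x z"
proof (cases "\<forall>x. f x = 0")
  case True
  then show ?thesis by (intro exI[of _ 0]) simp
next
  case False
  have bl: "bounded_linear f"
    by (rule bounded_linear_intro[of _ K])
      (auto simp: add scale scaleR_scaleC scaleR_conv_of_real bdd mult.commute)
  define S where "S = {x. f x = 1}"
  from False obtain x0 where "f x0 \<noteq> 0" by blast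
  then have "inverse (f x0) *\<^sub>C x0 \<in> S" by (simp add: S_def scale)
  then have S_ne: "S \<noteq> {}" by blast
  define d where "d = Inf (norm ` S)"
  have bb: "bdd_below (norm ` S)" by (rule bdd_belowI[of _ 0]) auto
  have d_le: "d \<le> norm x" if "x \<in> S" for x
    unfolding d_def using that bb by (simp add: cInf_lower)
  have d0: "d \<ge> 0" unfolding d_def using S_ne by (intro cInf_greatest) auto
  have "\<exists>x\<in>S. norm x < d + 1 / real (Suc n)" for n
  proof -
    have "Inf (norm ` S) < d + 1 / real (Suc n)" by (simp add: d_def)
    then show ?thesis using S_ne bb by (subst (asm) cInf_less_iff) auto
  qed
  then obtain X where X: "\<And>n. X n \<in> S" "\<And>n. norm (X n) < d + 1 / real (Suc n)"
    by metis
  have par: "(norm (x - y))\<^sup>2 \<le> 2 * (norm x)\<^sup>2 + 2 * (norm y)\<^sup>2 - 4 * d\<^sup>2"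
    if "x \<in> S" "y \<in> S" for x y
  proof -
    have "f ((1/2) *\<^sub>C (x + y)) = 1" using that by (simp add: S_def scale add)
    then have "d \<le> norm ((1/2) *\<^sub>C (x + y))" by (intro d_le) (simp add: S_def)
    then have "2 * d \<le> norm (x + y)" by (simp add: norm_scaleC norm_divide)
    then have "(2 * d)\<^sup>2 \<le> (norm (x + y))\<^sup>2" using d0 by (intro power_mono) auto
    moreover have "cinner (- y) x = - cinner y x"
      using cinner_diff_left[of 0 y x] by simp
    then have "(norm (x - y))\<^sup>2 = (norm x)\<^sup>2 - 2 * Re (cinner y x) + (norm y)\<^sup>2"
      using norm_add_cinner[of x "- y"] by simp
    ultimately show ?thesis using norm_add_cinner[of x y] by (simp add: power_mult_distrib)
  qed
  have lim_e: "(\<lambda>n. d + 1 / real (Suc n)) \<longlonglongrightarrow> d"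
    using tendsto_add[OF tendsto_const LIMSEQ_Suc[OF lim_1_over_n], of d] by simp
  have lim_n: "(\<lambda>n. norm (X n)) \<longlonglongrightarrow> d"
  proof (rule tendsto_sandwich[OF _ _ tendsto_const lim_e])
    show "\<forall>\<^sub>F n in sequentially. d \<le> norm (X n)"
      by (intro always_eventually allI d_le X(1))
    show "\<forall>\<^sub>F n in sequentially. norm (X n) \<le> d + 1 / real (Suc n)"
      by (intro always_eventually allI less_imp_le X(2))
  qed
  have "Cauchy X"
  proof (rule CauchyI)
    fix e :: real assume e: "e > 0"
    have "(\<lambda>n. (norm (X n))\<^sup>2) \<longlonglongrightarrow> d\<^sup>2" using lim_n by (rule tendsto_power)
    then have "\<forall>\<^sub>F n in sequentially. (norm (X n))\<^sup>2 < d\<^sup>2 + e\<^sup>2 / 4"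
      using e by (intro order_tendstoD(2)) auto
    then obtain M where M: "\<And>n. n \<ge> M \<Longrightarrow> (norm (X n))\<^sup>2 < d\<^sup>2 + e\<^sup>2 / 4"
      by (auto simp: eventually_sequentially)
    have "norm (X m - X n) < e" if "m \<ge> M" "n \<ge> M" for m n
    proof -
      have "(norm (X m - X n))\<^sup>2 < e\<^sup>2"
        using par[OF X(1) X(1), of m n] M[OF that(1)] M[OF that(2)] by linarith
      then show ?thesis by (rule power2_less_imp_less) (use e in simp)
    qed
    then show "\<exists>M. \<forall>m\<ge>M. \<forall>n\<ge>M. norm (X m - X n) < e" by blast
  qed
  then obtain u where u: "X \<longlonglongrightarrow> u" using Cauchy_convergent_iff convergent_def by blast
  have "(\<lambda>n. f (X n)) \<longlonglongrightarrow> f u" using bounded_linear.tendsto[OF bl u] .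
  moreover have "f (X n) = 1" for n using X(1) by (simp add: S_def)
  ultimately have fu: "f u = 1" by (simp add: LIMSEQ_const_iff)
  have nu: "norm u = d" using tendsto_norm[OF u] lim_n by (rule LIMSEQ_unique)
  have u0: "u \<noteq> 0" using fu scale[of 0 0] by auto
  have orth: "cinner v u = 0" if "f v = 0" for v
  proof (rule cinner_minimal)
    fix c
    show "norm u \<le> norm (u + c *\<^sub>C v)"
      unfolding nu by (rule d_le) (simp add: S_def add scale that fu)
  qed
  show ?thesis
  proof (intro exI allI)
    fix x
    have "f (x - f x *\<^sub>C u) = 0"
      using add[of "x - f x *\<^sub>C u" "f x *\<^sub>C u"] by (simp add: scale fu)
    then have "cinner (x - f x *\<^sub>C u) u = 0" by (rule orth)
    then have "cinner x u = f x * of_real ((norm u)\<^sup>2)"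
      by (simp only: cinner_diff_left cinner_scaleC_left cinner_self) simp
    then show "f x = cinner x (of_real (1 / (norm u)\<^sup>2) *\<^sub>C u)"
      using u0 by (simp add: cinner_scaleC_right)
  qed
qed


section \<open>C*-algebras\<close>

text \<open>No unit is required.\<close>

class cstar_algebra = complex_normed_vector + real_normed_algebra + banach +
  fixes star :: "'a \<Rightarrow> 'a"
  assumes scaleC_mult_left: "(c *\<^sub>C x) * y = c *\<^sub>C (x * y)"
    and scaleC_mult_right: "x * (c *\<^sub>C y) = c *\<^sub>C (x * y)"
    and star_star: "star (star x) = x"
    and star_add: "star (x + y) = star x + star y"
    and star_scaleC: "star (c *\<^sub>C x) = cnj c *\<^sub>C star x"
    and star_mult: "star (x * y) = star y * star x"
    and norm_star_mult: "norm (star x * x) = (norm x)\<^sup>2"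

lemma norm_star: "norm (star x) = norm (x::'a::cstar_algebra)"
proof -
  have le: "norm y \<le> norm (star y)" for y :: 'a
  proof (cases "y = 0")
    case False
    have "norm y * norm y \<le> norm (star y) * norm y"
      using norm_mult_ineq[of "star y" y] by (simp add: norm_star_mult power2_eq_square)
    then show ?thesis using False by simp
  qed simp
  from le[of x] le[of "star x"] show ?thesis by (simp add: star_star)
qed

instantiation complex :: cstar_algebra
begin

definition scaleC_complex :: "complex \<Rightarrow> complex \<Rightarrow> complex"
  where [simp]: "scaleC_complex = (*)"

definition star_complex :: "complex \<Rightarrow> complex"
  where [simp]: "star_complex = cnj"

instance
  by standard (simp_all add: algebra_simps norm_mult power2_eq_square scaleR_conv_of_real)

end


subsection \<open>Bounded operators on a Hilbert space\<close>

typedef (overloaded) 'h bop =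
  "{A :: 'h::complex_hilbert_space \<Rightarrow>\<^sub>L 'h. \<forall>c x. A (c *\<^sub>C x) = c *\<^sub>C A x}"
  morphisms blinfun_of_bop Bop
  by (rule exI[of _ 0]) simp

setup_lifting type_definition_bop

lift_definition bop_apply :: "'h::complex_hilbert_space bop \<Rightarrow> 'h \<Rightarrow> 'h" is blinfun_apply .

lemma bop_eqI: "(\<And>x. bop_apply A x = bop_apply B x) \<Longrightarrow> A = B"
  by transfer (rule blinfun_eqI)

lemma bop_apply_add: "bop_apply A (x + y) = bop_apply A x + bop_apply A y"
  by transfer (simp add: blinfun.add_right)

lemma bop_apply_scaleC: "bop_apply A (c *\<^sub>C x) = c *\<^sub>C bop_apply A x"
  by transfer simp

lemma scaleC_scaleR_commute: "c *\<^sub>C r *\<^sub>R x = r *\<^sub>R c *\<^sub>C (x::'a::complex_vector)"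
  by (simp add: scaleR_scaleC scaleC_scaleC mult.commute)

lemma bounded_linear_scaleC: "bounded_linear (\<lambda>x::'a::complex_normed_vector. c *\<^sub>C x)"
  by (rule bounded_linear_intro[of _ "cmod c"])
    (simp_all add: scaleC_add_right scaleC_scaleR_commute norm_scaleC mult.commute)

lift_definition blinfun_scaleC :: "complex \<Rightarrow> 'h::complex_normed_vector \<Rightarrow>\<^sub>L 'h"
  is "\<lambda>c x. c *\<^sub>C x"
  by (rule bounded_linear_scaleC)

lift_definition bop_of :: "('h \<Rightarrow> 'h::complex_hilbert_space) \<Rightarrow> 'h bop"
  is "\<lambda>f. if bounded_linear f \<and> (\<forall>c x. f (c *\<^sub>C x) = c *\<^sub>C f x) then Blinfun f else 0"
  by (auto simp: bounded_linear_Blinfun_apply)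

lemma bop_apply_bop_of:
  assumes "\<And>x y. f (x + y) = f x + f y" "\<And>c x. f (c *\<^sub>C x) = c *\<^sub>C f x"
    and "\<And>x. norm (f x) \<le> K * norm x"
  shows "bop_apply (bop_of f) = f"
proof -
  have "bounded_linear f"
    using assms
    by (intro bounded_linear_intro[of f K]) (auto simp: scaleR_scaleC mult.commute)
  with assms(2) show ?thesis
    by (simp add: bop_apply.rep_eq bop_of.rep_eq bounded_linear_Blinfun_apply)
qed

instantiation bop :: (complex_hilbert_space) complex_normed_vector
begin

lift_definition zero_bop :: "'a bop" is 0 by simp
lift_definition plus_bop :: "'a bop \<Rightarrow> 'a bop \<Rightarrow> 'a bop" is "(+)"
  by (simp add: blinfun.bilinear_simps scaleC_add_right)
lift_definition minus_bop :: "'a bop \<Rightarrow> 'a bop \<Rightarrow> 'a bop" is "(-)"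
  by (simp add: blinfun.bilinear_simps complex_vector.scale_right_diff_distrib)
lift_definition uminus_bop :: "'a bop \<Rightarrow> 'a bop" is uminus
  by (simp add: blinfun.bilinear_simps)
lift_definition scaleR_bop :: "real \<Rightarrow> 'a bop \<Rightarrow> 'a bop" is scaleR
  by (simp add: blinfun.bilinear_simps scaleC_scaleR_commute)
lift_definition scaleC_bop :: "complex \<Rightarrow> 'a bop \<Rightarrow> 'a bop" is "\<lambda>c A. blinfun_scaleC c o\<^sub>L A"
  by (simp add: blinfun_scaleC.rep_eq scaleC_scaleC mult.commute)
lift_definition norm_bop :: "'a bop \<Rightarrow> real" is norm .
lift_definition dist_bop :: "'a bop \<Rightarrow> 'a bop \<Rightarrow> real" is dist .

definition sgn_bop :: "'a bop \<Rightarrow> 'a bop" where "sgn_bop A = scaleR (inverse (norm A)) A"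
definition uniformity_bop :: "('a bop \<times> 'a bop) filter"
  where "uniformity_bop = (INF e\<in>{0<..}. principal {(A, B). dist A B < e})"
definition open_bop :: "'a bop set \<Rightarrow> bool"
  where "open_bop S = (\<forall>A\<in>S. \<forall>\<^sub>F (A', B) in uniformity. A' = A \<longrightarrow> B \<in> S)"

lemma bop_apply_simps [simp]:
  "bop_apply 0 x = 0"
  "bop_apply (A + B) x = bop_apply A x + bop_apply B x"
  "bop_apply (A - B) x = bop_apply A x - bop_apply B x"
  "bop_apply (- A) x = - bop_apply A x"
  "bop_apply (r *\<^sub>R A) x = r *\<^sub>R bop_apply A x"
  "bop_apply (c *\<^sub>C A) x = c *\<^sub>C bop_apply A x"
  by (transfer, simp add: blinfun.bilinear_simps blinfun_scaleC.rep_eq)+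

lemma norm_bop_apply: "norm (bop_apply A x) \<le> norm A * norm x"
  by transfer (rule norm_blinfun)

lemma norm_bop_bound:
  "0 \<le> b \<Longrightarrow> (\<And>x. norm (bop_apply A x) \<le> b * norm x) \<Longrightarrow> norm A \<le> b"
  by transfer (rule norm_blinfun_bound)

instance
proof
  fix A B C :: "'a bop" and c d :: complex and r t :: real
  show "norm (c *\<^sub>C A) = cmod c * norm A"
  proof -
    have le: "norm (c *\<^sub>C B) \<le> cmod c * norm B" for c and B :: "'a bop"
    proof (rule norm_bop_bound)
      have "norm B \<ge> 0" by transfer simp
      then show "0 \<le> cmod c * norm B" by simp
      show "norm (bop_apply (c *\<^sub>C B) x) \<le> cmod c * norm B * norm x" for x
        by (simp add: norm_scaleC mult.assoc mult_left_mono norm_bop_apply)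
    qed
    show ?thesis
    proof (cases "c = 0")
      case True
      have "norm (c *\<^sub>C A) \<le> 0" using le[of c A] True by simp
      moreover have "norm (c *\<^sub>C A) \<ge> 0" by transfer simp
      ultimately show ?thesis using True by simp
    next
      case False
      have eq: "inverse c *\<^sub>C c *\<^sub>C A = A"
        using False by (intro bop_eqI) (simp add: scaleC_scaleC)
      have "norm A \<le> inverse (cmod c) * norm (c *\<^sub>C A)"
        using le[of "inverse c" "c *\<^sub>C A"] unfolding eq by (simp add: norm_inverse)
      then have "cmod c * norm A \<le> norm (c *\<^sub>C A)" using False by (simp add: field_simps)
      with le[of c A] show ?thesis by simp
    qed
  qed
  show "A + B + C = A + (B + C)" "A + B = B + A" "0 + A = A" "- A + A = 0" "A - B = A + - B"
    by (auto intro!: bop_eqI)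
  show "r *\<^sub>R (A + B) = r *\<^sub>R A + r *\<^sub>R B" "(r + t) *\<^sub>R A = r *\<^sub>R A + t *\<^sub>R A"
    "r *\<^sub>R t *\<^sub>R A = (r * t) *\<^sub>R A" "1 *\<^sub>R A = A"
    by (auto intro!: bop_eqI simp: scaleR_add_right scaleR_add_left)
  show "c *\<^sub>C (A + B) = c *\<^sub>C A + c *\<^sub>C B" "(c + d) *\<^sub>C A = c *\<^sub>C A + d *\<^sub>C A"
    "c *\<^sub>C d *\<^sub>C A = (c * d) *\<^sub>C A" "1 *\<^sub>C A = A"
    by (auto intro!: bop_eqI
        simp: scaleC_add_right scaleC_add_left scaleC_scaleC scaleC_one)
  show "r *\<^sub>R A = complex_of_real r *\<^sub>C A"
    by (intro bop_eqI) (simp add: scaleR_scaleC)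
  show "dist A B = norm (A - B)" by transfer (rule dist_norm)
  show "sgn A = inverse (norm A) *\<^sub>R A" by (rule sgn_bop_def)
  show "(uniformity :: ('a bop \<times> 'a bop) filter)
      = (INF e\<in>{0<..}. principal {(A, B). dist A B < e})"
    by (rule uniformity_bop_def)
  show "open S \<longleftrightarrow> (\<forall>A\<in>S. \<forall>\<^sub>F (A', B) in uniformity. A' = A \<longrightarrow> B \<in> S)" for S :: "'a bop set"
    by (rule open_bop_def)
  show "norm A = 0 \<longleftrightarrow> A = 0" by transfer simp
  show "norm (A + B) \<le> norm A + norm B" by transfer (rule norm_triangle_ineq)
  show "norm (r *\<^sub>R A) = \<bar>r\<bar> * norm A" by transfer simp
qed

end

lemma bop_adjoint_ex:
  fixes A :: "'h::complex_hilbert_space bop"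
  shows "\<exists>B. \<forall>x y. cinner (bop_apply A x) y = cinner x (bop_apply B y)"
proof -
  have "\<exists>z. \<forall>x. cinner (bop_apply A x) y = cinner x z" for y
  proof (rule riesz_representation)
    fix x
    have "cmod (cinner (bop_apply A x) y) \<le> norm (bop_apply A x) * norm y"
      by (rule Cauchy_Schwarz_cinner)
    also have "\<dots> \<le> (norm A * norm x) * norm y"
      by (intro mult_right_mono norm_bop_apply) simp
    finally show "cmod (cinner (bop_apply A x) y) \<le> (norm A * norm y) * norm x"
      by (simp add: mult_ac)
  qed (simp_all add: bop_apply_add bop_apply_scaleC cinner_add_left cinner_scaleC_left)
  then have "\<exists>g. \<forall>y x. cinner (bop_apply A x) y = cinner x (g y)" by (intro choice allI)
  then obtain g where g: "\<And>x y. cinner (bop_apply A x) y = cinner x (g y)" by blast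
  have "norm (g y) \<le> norm A * norm y" for y
  proof (cases "g y = 0")
    case False
    have "norm (g y) * norm (g y) = cmod (cinner (g y) (g y))"
      by (simp add: cinner_self power2_eq_square norm_mult)
    also have "\<dots> = cmod (cinner (bop_apply A (g y)) y)" by (simp add: g)
    also have "\<dots> \<le> norm (bop_apply A (g y)) * norm y" by (rule Cauchy_Schwarz_cinner)
    also have "\<dots> \<le> (norm A * norm (g y)) * norm y"
      by (intro mult_right_mono norm_bop_apply) simp
    finally show ?thesis using False by (simp add: mult_ac)
  qed simp
  moreover have "g (y + z) = g y + g z" for y z
    by (rule cinner_eqI) (simp add: cinner_add_right flip: g)
  moreover have "g (c *\<^sub>C y) = c *\<^sub>C g y" for c y
    by (rule cinner_eqI) (simp add: cinner_scaleC_right flip: g)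
  ultimately have "bop_apply (bop_of g) = g" by (intro bop_apply_bop_of[of g "norm A"])
  with g show ?thesis by (intro exI[of _ "bop_of g"]) simp
qed

lemma bop_adjoint_ex1:
  fixes A :: "'h::complex_hilbert_space bop"
  shows "\<exists>!B. \<forall>x y. cinner (bop_apply A x) y = cinner x (bop_apply B y)"
proof (rule ex_ex1I[OF bop_adjoint_ex])
  fix B C :: "'h bop"
  assume "\<forall>x y. cinner (bop_apply A x) y = cinner x (bop_apply B y)"
    and "\<forall>x y. cinner (bop_apply A x) y = cinner x (bop_apply C y)"
  then show "B = C" by (intro bop_eqI cinner_eqI) simp
qed

instantiation bop :: (complex_hilbert_space) cstar_algebra
begin

lift_definition times_bop :: "'a bop \<Rightarrow> 'a bop \<Rightarrow> 'a bop" is "(o\<^sub>L)" by simp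

definition star_bop :: "'a bop \<Rightarrow> 'a bop"
  where "star_bop A = (THE B. \<forall>x y. cinner (bop_apply A x) y = cinner x (bop_apply B y))"

lemma bop_apply_times [simp]: "bop_apply (A * B) x = bop_apply A (bop_apply B x)"
  by transfer simp

lemma cinner_star_right: "cinner x (bop_apply (star A) y) = cinner (bop_apply A x) y"
  unfolding star_bop_def
  by (rule theI'[OF bop_adjoint_ex1, THEN spec, THEN spec, symmetric])

lemma cinner_star_left: "cinner (bop_apply (star A) x) y = cinner x (bop_apply A y)"
proof -
  have "cinner (bop_apply (star A) x) y = cnj (cinner y (bop_apply (star A) x))"
    by (rule cinner_commute)
  also have "\<dots> = cinner x (bop_apply A y)"
    unfolding cinner_star_right by (rule cinner_commute[symmetric])
  finally show ?thesis .
qed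

instance
proof
  fix A B C :: "'a bop" and c :: complex and r :: real
  show "A * B * C = A * (B * C)" by (rule bop_eqI) simp
  show "(A + B) * C = A * C + B * C" by (rule bop_eqI) simp
  show "A * (B + C) = A * B + A * C" by (rule bop_eqI) (simp add: bop_apply_add)
  show "r *\<^sub>R A * B = r *\<^sub>R (A * B)" by (rule bop_eqI) simp
  show "A * r *\<^sub>R B = r *\<^sub>R (A * B)"
    by (rule bop_eqI) (simp add: scaleR_scaleC bop_apply_scaleC)
  show "c *\<^sub>C A * B = c *\<^sub>C (A * B)" by (rule bop_eqI) simp
  show "A * c *\<^sub>C B = c *\<^sub>C (A * B)" by (rule bop_eqI) (simp add: bop_apply_scaleC)
  show norm_times: "norm (A * B) \<le> norm A * norm B" for A B :: "'a bop"
    by transfer (rule norm_blinfun_compose)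
  show "star (star A) = A"
    by (intro bop_eqI cinner_eqI) (simp add: cinner_star_right cinner_star_left)
  show "star (A + B) = star A + star B"
    by (intro bop_eqI cinner_eqI)
      (simp add: cinner_star_right cinner_add_left cinner_add_right)
  show "star (c *\<^sub>C A) = cnj c *\<^sub>C star A"
    by (intro bop_eqI cinner_eqI)
      (simp add: cinner_star_right cinner_scaleC_left cinner_scaleC_right)
  show "star (A * B) = star B * star A"
    by (intro bop_eqI cinner_eqI) (simp add: cinner_star_right)
  have sq: "(norm A)\<^sup>2 \<le> norm (star A * A)" for A :: "'a bop"
  proof -
    have "norm A \<le> sqrt (norm (star A * A))"
    proof (rule norm_bop_bound)
      fix x
      have "(norm (bop_apply A x))\<^sup>2 = cmod (cinner (bop_apply A x) (bop_apply A x))"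
        by (simp add: cinner_self norm_power)
      also have "\<dots> = cmod (cinner x (bop_apply (star A * A) x))"
        by (simp add: cinner_star_right)
      also have "\<dots> \<le> norm x * norm (bop_apply (star A * A) x)"
        by (rule Cauchy_Schwarz_cinner)
      also have "\<dots> \<le> norm x * (norm (star A * A) * norm x)"
        by (intro mult_left_mono norm_bop_apply) simp
      also have "\<dots> = (sqrt (norm (star A * A)) * norm x)\<^sup>2"
        by (simp add: power_mult_distrib) (simp add: power2_eq_square)
      finally show "norm (bop_apply A x) \<le> sqrt (norm (star A * A)) * norm x"
        by (rule power2_le_imp_le) simp
    qed simp
    then have "(norm A)\<^sup>2 \<le> (sqrt (norm (star A * A)))\<^sup>2" by (rule power_mono) simp
    then show ?thesis by simp
  qed
  have le: "norm A \<le> norm (star A)" for A :: "'a bop"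
  proof (cases "norm A = 0")
    case False
    have "norm A * norm A \<le> norm (star A) * norm A"
      using sq[of A] norm_times[of "star A" A] by (simp add: power2_eq_square)
    moreover have "norm A > 0" using False by simp
    ultimately show ?thesis by simp
  qed simp
  have "norm (star A) = norm A"
    using le[of A] le[of "star A"] \<open>star (star A) = A\<close> by simp
  then have "norm (star A * A) \<le> (norm A)\<^sup>2"
    using norm_times[of "star A" A] by (simp add: power2_eq_square)
  with sq[of A] show "norm (star A * A) = (norm A)\<^sup>2" by simp
next
  fix X :: "nat \<Rightarrow> 'a bop"
  assume "Cauchy X"
  then have "Cauchy (\<lambda>n. blinfun_of_bop (X n))"
    unfolding Cauchy_def dist_bop.rep_eq .
  then have "convergent (\<lambda>n. blinfun_of_bop (X n))" by (rule Cauchy_convergent)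
  then obtain L where L: "(\<lambda>n. blinfun_of_bop (X n)) \<longlonglongrightarrow> L"
    unfolding convergent_def by blast
  have ap: "(\<lambda>n. blinfun_of_bop (X n) x) \<longlonglongrightarrow> L x" for x
    by (intro blinfun.tendsto L tendsto_const)
  have "L (c *\<^sub>C x) = c *\<^sub>C L x" for c x
  proof (rule LIMSEQ_unique[OF ap])
    have "(\<lambda>n. c *\<^sub>C blinfun_of_bop (X n) x) \<longlonglongrightarrow> c *\<^sub>C L x"
      by (rule bounded_linear.tendsto[OF bounded_linear_scaleC ap])
    then show "(\<lambda>n. blinfun_of_bop (X n) (c *\<^sub>C x)) \<longlonglongrightarrow> c *\<^sub>C L x"
      by (simp add: bop_apply_scaleC flip: bop_apply.rep_eq)
  qed
  then have "blinfun_of_bop (Bop L) = L" by (simp add: Bop_inverse)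
  with L have "X \<longlonglongrightarrow> Bop L" unfolding tendsto_iff dist_bop.rep_eq by simp
  then show "convergent X" by (rule convergentI)
qed

end


subsection \<open>Bounded continuous functions with values in a C*-algebra\<close>

text \<open>
  The topology of \<^typ>\<open>nat\<close> is discrete, so \<^term>\<open>bcontfun :: (nat \<Rightarrow> 'a::metric_space) set\<close>
  consists of all bounded sequences.
\<close>

lemma bcontfun_nat: "bcontfun = {f :: nat \<Rightarrow> 'a::metric_space. bounded (range f)}"
  by (simp add: bcontfun_def)

setup_lifting type_definition_bcontfun

instance bcontfun :: (topological_space, complete_space) complete_space
proof
  fix f :: "nat \<Rightarrow> 'a \<Rightarrow>\<^sub>C 'b"
  assume "Cauchy f"
  then obtain g where "uniform_limit UNIV (\<lambda>n. apply_bcontfun (f n)) g sequentially"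
    using uniformly_convergent_eq_cauchy[of "\<lambda>_. True" "\<lambda>n. apply_bcontfun (f n)"]
    unfolding Cauchy_def uniform_limit_sequentially_iff
    by (metis dist_fun_lt_imp_dist_val_lt)
  from uniform_limit_bcontfunE[OF this sequentially_bot] show "convergent f"
    by (metis convergentI)
qed

instance bcontfun :: (topological_space, banach) banach ..

instantiation bcontfun :: (topological_space, cstar_algebra) cstar_algebra
begin

lift_definition times_bcontfun :: "('a \<Rightarrow>\<^sub>C 'b) \<Rightarrow> ('a \<Rightarrow>\<^sub>C 'b) \<Rightarrow> ('a \<Rightarrow>\<^sub>C 'b)"
  is "\<lambda>f g x. f x * g x"
proof -
  fix f g :: "'a \<Rightarrow> 'b"
  assume f: "f \<in> bcontfun" and g: "g \<in> bcontfun"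
  then obtain a b where "\<And>x. norm (f x) \<le> a" "\<And>x. norm (g x) \<le> b"
    by (auto simp: bcontfun_def bounded_iff)
  then have "norm (f x * g x) \<le> a * b" for x
    by (meson mult_mono norm_ge_zero norm_mult_ineq order_trans)
  then show "(\<lambda>x. f x * g x) \<in> bcontfun"
    using f g by (intro bcontfun_normI) (auto simp: bcontfun_def intro!: continuous_intros)
qed

lift_definition scaleC_bcontfun :: "complex \<Rightarrow> ('a \<Rightarrow>\<^sub>C 'b) \<Rightarrow> ('a \<Rightarrow>\<^sub>C 'b)"
  is "\<lambda>c f x. c *\<^sub>C f x"
proof -
  fix c and f :: "'a \<Rightarrow> 'b"
  assume f: "f \<in> bcontfun"
  then obtain a where "\<And>x. norm (f x) \<le> a"
    by (auto simp: bcontfun_def bounded_iff)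
  then have "norm (c *\<^sub>C f x) \<le> cmod c * a" for x
    by (simp add: norm_scaleC mult_left_mono)
  then show "(\<lambda>x. c *\<^sub>C f x) \<in> bcontfun"
    using f by (intro bcontfun_normI)
      (auto simp: bcontfun_def intro: bounded_linear.continuous_on[OF bounded_linear_scaleC])
qed

lift_definition star_bcontfun :: "('a \<Rightarrow>\<^sub>C 'b) \<Rightarrow> ('a \<Rightarrow>\<^sub>C 'b)"
  is "\<lambda>f x. star (f x)"
proof -
  fix f :: "'a \<Rightarrow> 'b"
  assume f: "f \<in> bcontfun"
  then obtain a where "\<And>x. norm (f x) \<le> a"
    by (auto simp: bcontfun_def bounded_iff)
  moreover have "bounded_linear (star :: 'b \<Rightarrow> 'b)"
    by (rule bounded_linear_intro[of _ 1])
      (simp_all add: star_add scaleR_scaleC star_scaleC norm_star)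
  ultimately show "(\<lambda>x. star (f x)) \<in> bcontfun"
    using f by (intro bcontfun_normI)
      (auto simp: bcontfun_def norm_star intro: bounded_linear.continuous_on)
qed

lemmas bcontfun_rep_eqs [simp] =
  times_bcontfun.rep_eq scaleC_bcontfun.rep_eq star_bcontfun.rep_eq

instance
proof
  fix f g h :: "'a \<Rightarrow>\<^sub>C 'b" and c d :: complex and r :: real
  show "c *\<^sub>C (f + g) = c *\<^sub>C f + c *\<^sub>C g" "(c + d) *\<^sub>C f = c *\<^sub>C f + d *\<^sub>C f"
    "c *\<^sub>C d *\<^sub>C f = (c * d) *\<^sub>C f" "1 *\<^sub>C f = f" "r *\<^sub>R f = complex_of_real r *\<^sub>C f"
    by (auto intro!: bcontfun_eqI
        simp: scaleC_add_right scaleC_add_left scaleC_scaleC scaleC_one scaleR_scaleC)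
  show "f * g * h = f * (g * h)" "(f + g) * h = f * h + g * h" "f * (g + h) = f * g + f * h"
    "r *\<^sub>R f * g = r *\<^sub>R (f * g)" "f * r *\<^sub>R g = r *\<^sub>R (f * g)"
    by (auto intro!: bcontfun_eqI simp: algebra_simps)
  show "c *\<^sub>C f * g = c *\<^sub>C (f * g)" "f * c *\<^sub>C g = c *\<^sub>C (f * g)" "star (star f) = f"
    "star (f + g) = star f + star g" "star (c *\<^sub>C f) = cnj c *\<^sub>C star f"
    "star (f * g) = star g * star f"
    by (auto intro!: bcontfun_eqI
        simp: scaleC_mult_left scaleC_mult_right star_star star_add star_scaleC star_mult)
  have le: "norm (c *\<^sub>C f) \<le> cmod c * norm f" for c and f :: "'a \<Rightarrow>\<^sub>C 'b"
    by (rule norm_bound) (auto simp: norm_scaleC intro: mult_left_mono norm_bounded)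
  show "norm (c *\<^sub>C f) = cmod c * norm f"
  proof (cases "c = 0")
    case True
    with le[of c f] show ?thesis by simp
  next
    case False
    have eq: "inverse c *\<^sub>C c *\<^sub>C f = f"
      using False by (intro bcontfun_eqI) (simp add: scaleC_scaleC scaleC_one)
    have "norm f \<le> inverse (cmod c) * norm (c *\<^sub>C f)"
      using le[of "inverse c" "c *\<^sub>C f"] unfolding eq by (simp add: norm_inverse)
    then have "cmod c * norm f \<le> norm (c *\<^sub>C f)" using False by (simp add: field_simps)
    with le[of c f] show ?thesis by simp
  qed
  show norm_times: "norm (f * g) \<le> norm f * norm g" for f g :: "'a \<Rightarrow>\<^sub>C 'b"
  proof (rule norm_bound)
    fix x
    have "norm (f x * g x) \<le> norm (f x) * norm (g x)" by (rule norm_mult_ineq)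
    also have "\<dots> \<le> norm f * norm g" by (intro mult_mono norm_bounded) auto
    finally show "norm ((f * g) x) \<le> norm f * norm g" by simp
  qed
  show "norm (star f * f) = (norm f)\<^sup>2"
  proof (rule antisym)
    have "norm (star f) \<le> norm f"
      by (rule norm_bound) (simp add: norm_star norm_bounded)
    then have "norm (star f) * norm f \<le> norm f * norm f" by (rule mult_right_mono) simp
    with norm_times[of "star f" f] show "norm (star f * f) \<le> (norm f)\<^sup>2"
      by (simp add: power2_eq_square)
    have "norm f \<le> sqrt (norm (star f * f))"
    proof (rule norm_bound)
      fix x
      have "(norm (f x))\<^sup>2 = norm ((star f * f) x)" by (simp add: norm_star_mult)
      also have "\<dots> \<le> norm (star f * f)" by (rule norm_bounded)
      finally show "norm (f x) \<le> sqrt (norm (star f * f))" by (rule real_le_rsqrt)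
    qed
    then have "(norm f)\<^sup>2 \<le> (sqrt (norm (star f * f)))\<^sup>2" by (rule power_mono) simp
    then show "(norm f)\<^sup>2 \<le> norm (star f * f)" by simp
  qed
qed

end

lifting_update bcontfun.lifting
lifting_forget bcontfun.lifting


section \<open>Tensor products of C*-algebras\<close>

text \<open>
  The free complex vector space on the set of pairs \<open>(a, b)\<close> is \<^typ>\<open>('a \<times> 'b) \<Rightarrow>\<^sub>0 complex\<close>.
  Its quotient by the subspace \<open>tensor_null\<close> is the algebraic tensor product, in which the class of
  \<^term>\<open>Poly_Mapping.single (a, b) (1::complex)\<close> is the elementary tensor of \<open>a\<close> and \<open>b\<close>.
\<close>

inductive_set tensor_null :: "('a::complex_vector \<times> 'b::complex_vector \<Rightarrow>\<^sub>0 complex) set" where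
  zero: "0 \<in> tensor_null"
| add: "p \<in> tensor_null \<Longrightarrow> q \<in> tensor_null \<Longrightarrow> p + q \<in> tensor_null"
| scale: "p \<in> tensor_null \<Longrightarrow> Poly_Mapping.map ((*) c) p \<in> tensor_null"
| add_left: "Poly_Mapping.single (a + a', b) 1
    - Poly_Mapping.single (a, b) 1 - Poly_Mapping.single (a', b) 1 \<in> tensor_null"
| add_right: "Poly_Mapping.single (a, b + b') 1
    - Poly_Mapping.single (a, b) 1 - Poly_Mapping.single (a, b') 1 \<in> tensor_null"
| scale_left: "Poly_Mapping.single (c *\<^sub>C a, b) 1 - Poly_Mapping.single (a, b) c \<in> tensor_null"
| scale_right: "Poly_Mapping.single (a, c *\<^sub>C b) 1 - Poly_Mapping.single (a, b) c \<in> tensor_null"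

definition tensor_lift ::
    "('a \<Rightarrow> 'b \<Rightarrow> 't::complex_vector) \<Rightarrow> ('a \<times> 'b \<Rightarrow>\<^sub>0 complex) \<Rightarrow> 't"
  where "tensor_lift \<tau> p =
    (\<Sum>(a, b)\<in>Poly_Mapping.keys p. Poly_Mapping.lookup p (a, b) *\<^sub>C \<tau> a b)"

text \<open>
  \<open>cstar_tensor_product \<tau>\<close> states that the C*-algebra \<open>'t\<close>, with \<open>\<tau> a b\<close> as elementary tensors,
  is a completion of the algebraic tensor product of \<open>'a\<close> and \<open>'b\<close> in some C*-norm: the first
  four conditions say that \<open>\<tau>\<close> induces a *-homomorphism from the algebraic tensor product to \<open>'t\<close>,
  the fifth that it is injective (so that the norm of \<open>'t\<close> pulls back to a C*-norm), the last that
  its range is dense. If \<open>'a\<close> or \<open>'b\<close> is nuclear, as every commutative C*-algebra is, then the C*-norm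
  is unique and \<open>'t\<close> is determined up to isomorphism.
\<close>

definition cstar_tensor_product ::
    "('a::cstar_algebra \<Rightarrow> 'b::cstar_algebra \<Rightarrow> 't::cstar_algebra) \<Rightarrow> bool"
  where "cstar_tensor_product \<tau> \<longleftrightarrow>
    (\<forall>b. clinear (\<lambda>a. \<tau> a b)) \<and>
    (\<forall>a. clinear (\<tau> a)) \<and>
    (\<forall>a b a' b'. \<tau> a b * \<tau> a' b' = \<tau> (a * a') (b * b')) \<and>
    (\<forall>a b. star (\<tau> a b) = \<tau> (star a) (star b)) \<and>
    (\<forall>p. tensor_lift \<tau> p = 0 \<longrightarrow> p \<in> tensor_null) \<and>
    closure (range (tensor_lift \<tau>)) = UNIV"


section \<open>Jordan homomorphisms\<close>

definition jordan_homomorphism :: "('a::cstar_algebra \<Rightarrow> 'b::cstar_algebra) \<Rightarrow> bool"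
  where "jordan_homomorphism \<phi> \<longleftrightarrow> clinear \<phi> \<and> (\<forall>x. \<phi> x * \<phi> x = \<phi> (x * x))"

end

theory Submission
  imports Defs
begin

text \<open>
  Write \<open>M\<close> for the algebra of bounded sequences in \<open>B(H)\<close> and \<open>T\<close> for the tensor product. The elements of
  \<open>T\<close> are norm limits of finite sums of elementary tensors, so they behave like sequences in \<open>B(H)\<close> with
  relatively compact range, that is, like continuous functions on the Stone-Cech compactification of
  \<open>\<nat>\<close>. At a point at infinity such a function still has a value in \<open>B(H)\<close>, and \<open>B(H)\<close> has no uncountable
  family of nonzero orthogonal idempotents, because \<open>H\<close> is separable. On the other hand, \<open>M\<close> contains a
  family of the cardinality of the continuum of projections that are orthogonal up to finitely many
  coordinates. A Jordan isomorphism would carry such a family into \<open>T\<close>, and evaluation at infinity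
  would turn it into an uncountable family of orthogonal idempotents in \<open>B(H)\<close>.

  \<^item> The evaluation at infinity is \<open>exists_evaluation_at_infinity\<close>. The map sending the elementary tensor
    of \<open>a\<close> and \<open>b\<close> to the multiple of \<open>b\<close> by the limit of \<open>a\<close> along a free filter is contractive, because the operator norm is dominated
    by every C*-norm on \<open>B(H)\<close> (\<open>norm_le_norm_star_embedding\<close>), so it extends to \<open>T\<close>.
  \<^item> The composition \<open>\<Psi>\<close> of a Jordan isomorphism \<open>M \<rightarrow> T\<close> with this evaluation vanishes on the sequences
    of finite support. The reason is that the coordinate projections of \<open>T\<close> correspond to orthogonal
    central idempotents of \<open>M\<close>, of which at most one is nonzero at any given coordinate
    (\<open>eventually_orthogonal_central_vanish\<close>).
  \<^item> The images under \<open>\<Psi>\<close> of the almost orthogonal projections must be nonzero, and no continuity of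
    the isomorphism is at hand. The projections are therefore chosen to be ranges of
    isometries, so that the unit is a Jordan expression in each of them up to an idempotent
    (\<open>no_unital_jordan_homomorphism_vanishing_on_finite_sequences\<close>).
\<close>

section \<open>Jordan homomorphisms\<close>

lemma clinear_add: "clinear f \<Longrightarrow> f (x + y) = f x + f y"
  and clinear_scaleC: "clinear f \<Longrightarrow> f (c *\<^sub>C x) = c *\<^sub>C f x"
  by (simp_all add: Vector_Spaces.linear_iff)

lemma clinear_zero: "clinear f \<Longrightarrow> f 0 = 0"
  using clinear_scaleC[of f 0 0] by simp

lemma clinear_diff: "clinear f \<Longrightarrow> f (x - y) = f x - f y"
  using clinear_add[of f "x - y" y] by simp

lemma clinearI:
  "(\<And>x y. f (x + y) = f x + f y) \<Longrightarrow> (\<And>c x. f (c *\<^sub>C x) = c *\<^sub>C f x) \<Longrightarrow> clinear f"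
  by (simp add: Vector_Spaces.linear_iff complex_vector.vector_space_axioms)

text \<open>Jordan expressions carry factors of two, which are cancelled with this rule.\<close>

lemma double_eq_iff:
  fixes x y :: "'a::real_vector"
  shows "x + x = y + y \<longleftrightarrow> x = y"
  by (simp flip: scaleR_2)

lemma jordan_clinear: "jordan_homomorphism \<phi> \<Longrightarrow> clinear \<phi>"
  by (simp add: jordan_homomorphism_def)

lemma jordan_square: "jordan_homomorphism \<phi> \<Longrightarrow> \<phi> (x * x) = \<phi> x * \<phi> x"
  by (simp add: jordan_homomorphism_def)

lemma jordan_anticommutator:
  assumes \<phi>: "jordan_homomorphism \<phi>"
  shows "\<phi> (x * y + y * x) = \<phi> x * \<phi> y + \<phi> y * \<phi> x"
proof -
  note add = clinear_add[OF jordan_clinear[OF \<phi>]]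
  have "\<phi> ((x + y) * (x + y)) = \<phi> (x + y) * \<phi> (x + y)"
    by (rule jordan_square[OF \<phi>])
  then show ?thesis
    by (simp add: distrib_left distrib_right add jordan_square[OF \<phi>] add.commute)
qed

text \<open>
  The product \<open>a * x * a\<close> is a Jordan expression: with \<open>a \<circ> x = a * x + x * a\<close>, twice this product
  is \<open>a \<circ> (a \<circ> x) - (a * a) \<circ> x\<close>.
\<close>

lemma jordan_triple:
  assumes \<phi>: "jordan_homomorphism \<phi>"
  shows "\<phi> (a * x * a) = \<phi> a * \<phi> x * \<phi> a"
proof -
  note lin = clinear_add[OF jordan_clinear[OF \<phi>]] clinear_diff[OF jordan_clinear[OF \<phi>]]
  have J: "u * v * u + u * v * u = (u * (u * v + v * u) + (u * v + v * u) * u)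
      - ((u * u) * v + v * (u * u))" for u v :: "'x::ring"
    by (simp add: algebra_simps)
  have "\<phi> (a * x * a) + \<phi> (a * x * a) = \<phi> (a * x * a + a * x * a)"
    by (simp only: lin)
  also have "\<dots> = \<phi> (a * (a * x + x * a) + (a * x + x * a) * a) - \<phi> ((a * a) * x + x * (a * a))"
    unfolding J[of a x] lin(2) ..
  also have "\<dots> = \<phi> a * \<phi> x * \<phi> a + \<phi> a * \<phi> x * \<phi> a"
    unfolding jordan_anticommutator[OF \<phi>] jordan_square[OF \<phi>] J[of "\<phi> a" "\<phi> x"] ..
  finally show ?thesis by (simp only: double_eq_iff)
qed

lemma jordan_triple_polarized:
  assumes \<phi>: "jordan_homomorphism \<phi>"
  shows "\<phi> (a * x * b + b * x * a) = \<phi> a * \<phi> x * \<phi> b + \<phi> b * \<phi> x * \<phi> a"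
proof -
  note add = clinear_add[OF jordan_clinear[OF \<phi>]]
  have "\<phi> ((a + b) * x * (a + b)) = \<phi> (a + b) * \<phi> x * \<phi> (a + b)"
    by (rule jordan_triple[OF \<phi>])
  then show ?thesis
    by (simp add: distrib_left distrib_right add jordan_triple[OF \<phi>] add.commute)
qed

lemma jordan_inverse:
  assumes \<phi>: "jordan_homomorphism \<phi>" and "bij \<phi>"
  shows "jordan_homomorphism (inv \<phi>)"
proof -
  have cancel: "\<phi> (inv \<phi> y) = y" "inv \<phi> (\<phi> x) = x" for x y
    using \<open>bij \<phi>\<close> by (simp_all add: bij_is_surj bij_is_inj surj_f_inv_f)
  have eq: "inv \<phi> z = x" if "\<phi> x = z" for x z
    using that cancel(2) by blast
  have "clinear (inv \<phi>)"
    by (intro clinearI eq)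
      (simp_all add: clinear_add clinear_scaleC jordan_clinear[OF \<phi>] cancel)
  moreover have "inv \<phi> x * inv \<phi> x = inv \<phi> (x * x)" for x
    by (rule eq[symmetric]) (simp add: jordan_square[OF \<phi>] cancel)
  ultimately show ?thesis by (simp add: jordan_homomorphism_def)
qed

text \<open>
  A central idempotent \<open>f\<close> satisfies the Jordan identity \<open>2 * f * x * f = f * x + x * f\<close>, which passes to the
  image \<open>g\<close> of \<open>f\<close>. Multiplying it by \<open>g\<close> on the left and on the right gives \<open>g * y = g * y * g = y * g\<close>.
\<close>

lemma jordan_surj_central_idempotent:
  assumes \<phi>: "jordan_homomorphism \<phi>" and "surj \<phi>"
    and idem: "f * f = f" and central: "\<And>x. f * x = x * f"
  shows "\<phi> f * y = y * \<phi> f"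
proof -
  define g where "g = \<phi> f"
  obtain x where y: "y = \<phi> x" using \<open>surj \<phi>\<close> by blast
  have gg: "g * g = g" using jordan_square[OF \<phi>, of f] by (simp add: g_def idem)
  then have gg': "g * (g * z) = g * z" for z by (metis mult.assoc)
  have "f * x * f + f * x * f = f * x + x * f"
    by (metis central idem mult.assoc)
  then have "\<phi> (f * x * f + f * x * f) = \<phi> (f * x + x * f)" by simp
  then have eq: "g * y * g + g * y * g = g * y + y * g"
    by (simp only: jordan_triple_polarized[OF \<phi>] jordan_anticommutator[OF \<phi>] g_def y)
  have "g * (g * y * g + g * y * g) = g * (g * y + y * g)" by (simp only: eq)
  then have left: "g * y * g = g * y"
    by (simp add: distrib_left mult.assoc gg gg')
  have "(g * y * g + g * y * g) * g = (g * y + y * g) * g" by (simp only: eq)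
  then have "g * y * g = y * g"
    by (simp add: distrib_right mult.assoc gg)
  with left show ?thesis by (simp add: g_def)
qed

text \<open>
  Orthogonality of idempotents can be read off from their anticommutator, hence is preserved by
  Jordan homomorphisms.
\<close>

lemma anticommuting_idempotents_orthogonal:
  fixes p q :: "'a::{ring, real_vector}"
  assumes "p * p = p" "p * q + q * p = 0"
  shows "p * q = 0"
proof -
  have pq: "p * q = - (q * p)" using assms(2) by (simp add: eq_neg_iff_add_eq_0)
  have "p * q = p * (p * q)" by (simp add: assms(1) flip: mult.assoc)
  also have "\<dots> = p * (- (q * p))" by (simp only: pq)
  also have "\<dots> = - ((p * q) * p)" by (simp add: mult.assoc)
  also have "\<dots> = q * p" unfolding pq by (simp add: mult.assoc assms(1))
  finally have "p * q + p * q = 0 + 0" using assms(2) by simp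
  then show ?thesis by (simp only: double_eq_iff)
qed

section \<open>Identity and rank one operators\<close>

definition bop_id :: "'h::complex_hilbert_space bop"
  where "bop_id = bop_of (\<lambda>x. x)"

lemma bop_apply_id [simp]: "bop_apply bop_id x = x"
  unfolding bop_id_def by (subst bop_apply_bop_of[of _ 1]) auto

lemma bop_id_mult [simp]: "bop_id * A = A" "A * bop_id = A"
  by (auto intro: bop_eqI)

lemma star_bop_id [simp]: "star bop_id = bop_id"
  by (intro bop_eqI cinner_eqI) (simp add: cinner_star_right)

definition rank_one :: "'h::complex_hilbert_space \<Rightarrow> 'h \<Rightarrow> 'h bop"
  where "rank_one x y = bop_of (\<lambda>z. cinner z y *\<^sub>C x)"

lemma bop_apply_rank_one [simp]: "bop_apply (rank_one x y) z = cinner z y *\<^sub>C x"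
proof -
  have "norm (cinner z y *\<^sub>C x) \<le> (norm y * norm x) * norm z" for z
    using mult_right_mono[OF Cauchy_Schwarz_cinner[of z y], of "norm x"]
    by (simp add: norm_scaleC mult_ac)
  then show ?thesis
    unfolding rank_one_def
    by (subst bop_apply_bop_of[of _ "norm y * norm x"])
      (auto simp: cinner_add_left cinner_scaleC_left scaleC_add_left scaleC_scaleC)
qed

text \<open>
  \<open>B(H)\<close> is a prime ring, since a rank one operator can carry a given nonzero vector in the range of
  \<open>B\<close> to a vector on which \<open>A\<close> does not vanish. This replaces a computation of the center of \<open>B(H)\<close>.
\<close>

lemma bop_prime:
  fixes A B :: "'h::complex_hilbert_space bop"
  assumes "\<And>R. A * R * B = 0"
  shows "A = 0 \<or> B = 0"
proof (rule ccontr)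
  assume "\<not> (A = 0 \<or> B = 0)"
  then have "\<exists>x. bop_apply A x \<noteq> 0" "\<exists>y. bop_apply B y \<noteq> 0"
    by (metis bop_eqI bop_apply_simps(1))+
  then obtain x y where xy: "bop_apply A x \<noteq> 0" "bop_apply B y \<noteq> 0" by blast
  have "bop_apply (A * rank_one x (bop_apply B y) * B) y = 0"
    by (simp only: assms bop_apply_simps)
  then have "cinner (bop_apply B y) (bop_apply B y) *\<^sub>C bop_apply A x = 0"
    by (simp add: bop_apply_scaleC)
  with xy show False by (simp add: cinner_self)
qed

text \<open>
  The operator norm is the least C*-norm on \<open>B(H)\<close>: if \<open>P\<close> is the rank one operator of a vector \<open>x\<close>,
  then \<open>star (A * P) * (A * P)\<close> is the multiple of \<open>P\<close> by the square of the norm of \<open>A x\<close>,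
  so that the norm of \<open>A x\<close> can be computed from the norms of \<open>\<pi> (A * P)\<close> and \<open>\<pi> P\<close>.
\<close>

lemma norm_le_norm_star_embedding:
  fixes \<pi> :: "'h::complex_hilbert_space bop \<Rightarrow> 't::cstar_algebra"
  assumes mult: "\<And>A B. \<pi> (A * B) = \<pi> A * \<pi> B"
    and star: "\<And>A. \<pi> (star A) = star (\<pi> A)"
    and scale: "\<And>c A. \<pi> (c *\<^sub>C A) = c *\<^sub>C \<pi> A"
    and inj: "\<And>A. \<pi> A = 0 \<Longrightarrow> A = 0"
  shows "norm A \<le> norm (\<pi> A)"
proof (rule norm_bop_bound)
  fix x
  show "norm (bop_apply A x) \<le> norm (\<pi> A) * norm x"
  proof (cases "x = 0")
    case True
    then show ?thesis using bop_apply_scaleC[of A 0 0] by simp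
  next
    case False
    define P where "P = rank_one x x"
    have "bop_apply P x \<noteq> 0" using False by (simp add: P_def cinner_self)
    then have "P \<noteq> 0" by force
    then have P0: "norm (\<pi> P) > 0" using inj by auto
    have AP: "star (A * P) * (A * P) = of_real ((norm (bop_apply A x))\<^sup>2) *\<^sub>C P" for A :: "'h bop"
    proof (intro bop_eqI cinner_eqI)
      fix z y
      have "cinner x (bop_apply (star A) (bop_apply A x)) = of_real ((norm (bop_apply A x))\<^sup>2)"
        by (simp add: cinner_star_right cinner_self)
      then show "cinner y (bop_apply (star (A * P) * (A * P)) z)
          = cinner y (bop_apply (of_real ((norm (bop_apply A x))\<^sup>2) *\<^sub>C P) z)"
        by (simp add: P_def cinner_star_right cinner_scaleC_left cinner_scaleC_right
            bop_apply_scaleC cinner_self)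
    qed
    have "norm (\<pi> (star (A * P) * (A * P))) = (norm (\<pi> (A * P)))\<^sup>2" for A
      by (simp only: mult[of "star (A * P)"] star norm_star_mult)
    then have N: "(norm (bop_apply A x))\<^sup>2 * norm (\<pi> P) = (norm (\<pi> (A * P)))\<^sup>2" for A
      by (simp add: AP scale norm_scaleC norm_power)
    have P: "norm (\<pi> P) = (norm x)\<^sup>2"
      using N[of bop_id] P0 by (simp add: power2_eq_square)
    have "(norm (\<pi> (A * P)))\<^sup>2 \<le> (norm (\<pi> A) * norm (\<pi> P))\<^sup>2"
      unfolding mult by (intro power_mono norm_mult_ineq) simp
    also have "\<dots> = (norm (\<pi> A) * norm x)\<^sup>2 * norm (\<pi> P)"
      by (simp add: P power_mult_distrib power2_eq_square mult_ac)
    finally have "(norm (bop_apply A x))\<^sup>2 * norm (\<pi> P) \<le> (norm (\<pi> A) * norm x)\<^sup>2 * norm (\<pi> P)"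
      by (simp only: N)
    then have "(norm (bop_apply A x))\<^sup>2 \<le> (norm (\<pi> A) * norm x)\<^sup>2" using P0 by simp
    then show ?thesis by (rule power2_le_imp_le) simp
  qed
qed simp

section \<open>Isometries with orthogonal ranges\<close>

lemma cinner_uminus_left: "cinner (- x) y = - cinner x y"
  using cinner_diff_left[of 0 x y] by simp

lemma cinner_sum_left: "cinner (sum f F) y = (\<Sum>i\<in>F. cinner (f i) y)"
  by (induction F rule: infinite_finite_induct) (auto simp: cinner_add_left)

lemma cinner_sum_right: "cinner y (sum f F) = (\<Sum>i\<in>F. cinner y (f i))"
  by (induction F rule: infinite_finite_induct) (auto simp: cinner_add_right)

lemma cinner_eq_0_commute: "cinner x y = 0 \<longleftrightarrow> cinner y x = 0"
  by (metis cinner_commute complex_cnj_zero)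

lemma norm_add_orthogonal:
  "cinner y x = 0 \<Longrightarrow> (norm (x + y))\<^sup>2 = (norm x)\<^sup>2 + (norm y)\<^sup>2"
  by (simp add: norm_add_cinner)

definition orthonormal :: "'h::complex_hilbert_space set \<Rightarrow> bool"
  where "orthonormal X \<longleftrightarrow> (\<forall>x\<in>X. \<forall>y\<in>X. cinner x y = (if x = y then 1 else 0))"

lemma orthonormalD:
  "orthonormal X \<Longrightarrow> x \<in> X \<Longrightarrow> y \<in> X \<Longrightarrow> cinner x y = (if x = y then 1 else 0)"
  unfolding orthonormal_def by blast

lemma orthonormal_norm: "orthonormal X \<Longrightarrow> x \<in> X \<Longrightarrow> norm x = 1"
proof -
  assume "orthonormal X" "x \<in> X"
  then have "complex_of_real ((norm x)\<^sup>2) = 1"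
    unfolding orthonormal_def cinner_self[symmetric] by simp
  then have "(norm x)\<^sup>2 = 1" by (simp only: of_real_eq_1_iff)
  then show ?thesis using norm_ge_zero[of x] power2_eq_1_iff[of "norm x"] by linarith
qed

text \<open>
  In a Hilbert space this is equivalent to density of the linear span; the form chosen here is the
  one that maximality of an orthonormal set yields and that operator identities need.
\<close>

definition total_set :: "'h::complex_hilbert_space set \<Rightarrow> bool"
  where "total_set X \<longleftrightarrow> (\<forall>y. (\<forall>x\<in>X. cinner y x = 0) \<longrightarrow> y = 0)"

text \<open>
  By the lemma of Zorn there is a maximal orthonormal set, and a nonzero vector orthogonal to it
  could be normalized and added to it.
\<close>

lemma exists_total_orthonormal: "\<exists>X::'h::complex_hilbert_space set. orthonormal X \<and> total_set X"
proof -
  have "\<exists>M\<in>{X::'h set. orthonormal X}. \<forall>X\<in>{X. orthonormal X}. M \<subseteq> X \<longrightarrow> X = M"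
  proof (rule subset_Zorn')
    fix C :: "'h set set"
    assume chain: "subset.chain {X. orthonormal X} C"
    have chain': "\<And>X. X \<in> C \<Longrightarrow> orthonormal X" "\<And>X Y. X \<in> C \<Longrightarrow> Y \<in> C \<Longrightarrow> X \<subseteq> Y \<or> Y \<subseteq> X"
      using chain unfolding subset_chain_def by blast+
    have "cinner x y = (if x = y then 1 else 0)" if xy: "x \<in> \<Union>C" "y \<in> \<Union>C" for x y
    proof -
      obtain X Y where XY: "X \<in> C" "Y \<in> C" "x \<in> X" "y \<in> Y" using xy by blast
      from chain'(2)[OF XY(1,2)] XY obtain Z where Z: "Z \<in> C" "x \<in> Z" "y \<in> Z" by blast
      from orthonormalD[OF chain'(1)[OF Z(1)] Z(2,3)] show ?thesis .
    qed
    then show "\<Union>C \<in> {X. orthonormal X}" unfolding orthonormal_def by blast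
  qed
  then obtain M :: "'h set" where M: "orthonormal M"
    and "\<forall>X\<in>{X. orthonormal X}. M \<subseteq> X \<longrightarrow> X = M" by auto
  then have max: "\<And>X. orthonormal X \<Longrightarrow> M \<subseteq> X \<Longrightarrow> X = M" by simp
  have "y = 0" if y: "\<And>x. x \<in> M \<Longrightarrow> cinner y x = 0" for y
  proof (rule ccontr)
    assume "y \<noteq> 0"
    define u where "u = complex_of_real (inverse (norm y)) *\<^sub>C y"
    have "norm u = 1" using \<open>y \<noteq> 0\<close> by (simp add: u_def norm_scaleC norm_inverse)
    then have uu: "cinner u u = 1" by (simp only: cinner_self) simp
    have ux: "cinner u x = 0" if "x \<in> M" for x
      using y[OF that] by (simp add: u_def cinner_scaleC_left)
    have xu: "cinner x u = 0" if "x \<in> M" for x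
      using ux[OF that] by (rule cinner_eq_0_commute[THEN iffD1])
    have "u \<notin> M"
    proof
      assume "u \<in> M"
      from ux[OF this] show False by (simp only: uu zero_neq_one[symmetric])
    qed
    have "orthonormal (insert u M)"
      unfolding orthonormal_def
    proof (intro ballI)
      fix x y assume "x \<in> insert u M" "y \<in> insert u M"
      then show "cinner x y = (if x = y then 1 else 0)"
        using orthonormalD[OF M, of x y] uu ux[of y] xu[of x] \<open>u \<notin> M\<close> by auto
    qed
    then have "insert u M = M" by (rule max) blast
    with \<open>u \<notin> M\<close> show False by blast
  qed
  with M show ?thesis unfolding total_set_def by blast
qed

text \<open>
  The balls of radius \<open>r i\<close> around the points \<open>f i\<close> are disjoint, and each of them meets a countable
  dense set. The radius may depend on the point, since the idempotents considered below are not
  uniformly bounded.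
\<close>

lemma countable_if_separated:
  fixes f :: "'i \<Rightarrow> 'a::metric_space"
  assumes sep: "separable_space (euclidean :: 'a topology)"
    and r: "\<And>i. i \<in> I \<Longrightarrow> r i > 0"
    and far: "\<And>i j. i \<in> I \<Longrightarrow> j \<in> I \<Longrightarrow> i \<noteq> j \<Longrightarrow> r i + r j \<le> dist (f i) (f j)"
  shows "countable I"
proof -
  obtain D :: "'a set" where D: "countable D" "closure D = UNIV"
    using sep unfolding separable_space_def by auto
  have "\<exists>d\<in>D. dist d (f i) < r i" if "i \<in> I" for i
  proof -
    have "f i \<in> closure D" by (simp add: D(2))
    then show ?thesis using r[OF that] unfolding closure_approachable by blast
  qed
  then obtain d where "\<forall>i\<in>I. d i \<in> D \<and> dist (d i) (f i) < r i"
    using bchoice[of I "\<lambda>i d. d \<in> D \<and> dist d (f i) < r i"] by blast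
  then have d: "\<And>i. i \<in> I \<Longrightarrow> d i \<in> D" "\<And>i. i \<in> I \<Longrightarrow> dist (d i) (f i) < r i"
    by blast+
  have "inj_on d I"
  proof (rule inj_onI, rule ccontr)
    fix i j assume ij: "i \<in> I" "j \<in> I" "d i = d j" "i \<noteq> j"
    have "dist (f i) (f j) \<le> dist (d i) (f i) + dist (d i) (f j)"
      by (metis dist_commute dist_triangle)
    also have "\<dots> < r i + r j" using d(2)[OF ij(1)] d(2)[OF ij(2)] ij(3) by simp
    finally show False using far[OF ij(1,2,4)] by simp
  qed
  moreover have "countable (d ` I)" using D(1) d(1) by (meson countable_subset image_subsetI)
  ultimately show ?thesis by (rule countable_image_inj_on[rotated])
qed

lemma orthonormal_countable:
  fixes X :: "'h::complex_hilbert_space set"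
  assumes sep: "separable_space (euclidean :: 'h topology)" and X: "orthonormal X"
  shows "countable X"
proof (rule countable_if_separated[OF sep, where f = "\<lambda>x. x" and r = "\<lambda>_. 1/2"])
  fix x y assume xy: "x \<in> X" "y \<in> X" "x \<noteq> y"
  then have "cinner (- y) x = 0"
    using orthonormalD[OF X, of y x] by (auto simp: cinner_uminus_left)
  then have "(norm (x - y))\<^sup>2 = (norm x)\<^sup>2 + (norm y)\<^sup>2"
    using norm_add_orthogonal[of "- y" x] by simp
  then have "1\<^sup>2 \<le> (norm (x - y))\<^sup>2" using xy by (simp add: orthonormal_norm[OF X])
  then have "1 \<le> norm (x - y)" by (rule power2_le_imp_le) simp
  then show "1/2 + 1/2 \<le> dist x y" by (simp add: dist_norm)
qed simp

text \<open>
  The orthogonal projection of \<open>y\<close> to the span of a finite orthonormal set differs from \<open>y\<close> by a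
  vector orthogonal to the set.
\<close>

lemma orthonormal_total_infinite:
  fixes X :: "'h::complex_hilbert_space set"
  assumes inf: "\<not> (\<exists>B::'h::complex_hilbert_space set. finite B \<and> cspan B = UNIV)"
    and X: "orthonormal X" "total_set X"
  shows "infinite X"
proof
  assume fin: "finite X"
  have "y \<in> cspan X" for y
  proof -
    define s where "s = (\<Sum>x\<in>X. cinner y x *\<^sub>C x)"
    have "cinner (y - s) z = 0" if "z \<in> X" for z
    proof -
      have "cinner s z = (\<Sum>x\<in>X. if x = z then cinner y x else 0)"
        unfolding s_def cinner_sum_left cinner_scaleC_left
        using that by (intro sum.cong) (simp_all add: orthonormalD[OF X(1)])
      also have "\<dots> = cinner y z" using fin that by simp
      finally show ?thesis by (simp add: cinner_diff_left)
    qed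
    then have "y - s = 0" using X(2) unfolding total_set_def by blast
    moreover have "s \<in> cspan X"
      unfolding s_def by (intro complex_vector.span_sum complex_vector.span_scale complex_vector.span_base)
    ultimately show ?thesis by simp
  qed
  with fin inf show False by blast
qed

lemma exists_orthonormal_basis:
  assumes sep: "separable_space (euclidean :: 'h::complex_hilbert_space topology)"
    and inf: "\<not> (\<exists>B::'h::complex_hilbert_space set. finite B \<and> cspan B = UNIV)"
  obtains e :: "nat \<Rightarrow> 'h::complex_hilbert_space"
  where "\<And>i j. cinner (e i) (e j) = (if i = j then 1 else 0)" "total_set (range e)"
proof -
  obtain X :: "'h set" where X: "orthonormal X" "total_set X"
    using exists_total_orthonormal by blast
  obtain k :: "'h \<Rightarrow> nat" where "bij_betw k X UNIV"
    using countableE_infinite[OF orthonormal_countable[OF sep X(1)]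
        orthonormal_total_infinite[OF inf X]] by blast
  then obtain e :: "nat \<Rightarrow> 'h" where e: "bij_betw e UNIV X"
    using bij_betw_inv by blast
  then have "inj e" "range e = X" by (auto simp: bij_betw_def)
  show ?thesis
  proof
    have "orthonormal (range e)" unfolding \<open>range e = X\<close> by (rule X(1))
    then show "cinner (e i) (e j) = (if i = j then 1 else 0)" for i j
      unfolding orthonormal_def by (simp add: inj_eq[OF \<open>inj e\<close>])
    show "total_set (range e)" unfolding \<open>range e = X\<close> by (rule X(2))
  qed
qed

lemma norm_sum_orthonormal:
  fixes e :: "nat \<Rightarrow> 'h::complex_hilbert_space"
  assumes e: "\<And>i j. cinner (e i) (e j) = (if i = j then 1 else 0)" and "finite F"
  shows "(norm (\<Sum>i\<in>F. c i *\<^sub>C e i))\<^sup>2 = (\<Sum>i\<in>F. (cmod (c i))\<^sup>2)"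
  using \<open>finite F\<close>
proof induction
  case (insert i F)
  have "cinner (\<Sum>i\<in>F. c i *\<^sub>C e i) (c i *\<^sub>C e i) = 0"
    unfolding cinner_sum_left cinner_scaleC_left cinner_scaleC_right
    using insert.hyps by (subst sum.neutral) (auto simp: e)
  then have "(norm (\<Sum>i\<in>insert i F. c i *\<^sub>C e i))\<^sup>2
      = (norm (c i *\<^sub>C e i))\<^sup>2 + (norm (\<Sum>i\<in>F. c i *\<^sub>C e i))\<^sup>2"
    using insert.hyps norm_add_orthogonal[OF \<open>cinner (\<Sum>i\<in>F. c i *\<^sub>C e i) (c i *\<^sub>C e i) = 0\<close>]
    by simp
  moreover have "norm (e i) = 1"
    by (rule orthonormal_norm[of "{e i}"]) (simp_all add: orthonormal_def e)
  ultimately show ?case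
    using insert by (simp add: norm_scaleC)
qed simp

lemma bessel_inequality:
  fixes e :: "nat \<Rightarrow> 'h::complex_hilbert_space"
  assumes e: "\<And>i j. cinner (e i) (e j) = (if i = j then 1 else 0)" and "finite F"
  shows "(\<Sum>i\<in>F. (cmod (cinner y (e i)))\<^sup>2) \<le> (norm y)\<^sup>2"
proof -
  define s where "s = (\<Sum>i\<in>F. cinner y (e i) *\<^sub>C e i)"
  have se: "cinner s (e j) = cinner y (e j)" if "j \<in> F" for j
  proof -
    have "cinner s (e j) = (\<Sum>i\<in>F. if i = j then cinner y (e i) else 0)"
      unfolding s_def cinner_sum_left cinner_scaleC_left by (intro sum.cong) (auto simp: e)
    also have "\<dots> = cinner y (e j)" using \<open>finite F\<close> that by simp
    finally show ?thesis .
  qed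
  have "cinner (y - s) (\<Sum>i\<in>F. cinner y (e i) *\<^sub>C e i) = 0"
    unfolding cinner_sum_right cinner_scaleC_right
    by (intro sum.neutral) (simp add: cinner_diff_left se)
  then have "cinner (y - s) s = 0" by (simp only: s_def)
  then have "(norm (s + (y - s)))\<^sup>2 = (norm s)\<^sup>2 + (norm (y - s))\<^sup>2"
    by (rule norm_add_orthogonal)
  moreover have "(norm s)\<^sup>2 = (\<Sum>i\<in>F. (cmod (cinner y (e i)))\<^sup>2)"
    unfolding s_def by (rule norm_sum_orthonormal[OF e \<open>finite F\<close>])
  ultimately show ?thesis by simp
qed

text \<open>
  Every injection of the index set of an orthonormal basis permits to shift the basis vectors by an
  isometry; the series of the images converges by the inequality of Bessel.
\<close>

lemma exists_shift_operator:
  fixes e :: "nat \<Rightarrow> 'h::complex_hilbert_space"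
  assumes e: "\<And>i j. cinner (e i) (e j) = (if i = j then 1 else 0)" and \<sigma>: "inj \<sigma>"
  shows "\<exists>S. norm S \<le> 1 \<and> (\<forall>i. bop_apply S (e i) = e (\<sigma> i))"
proof -
  have e\<sigma>: "cinner (e (\<sigma> i)) (e (\<sigma> j)) = (if i = j then 1 else 0)" for i j
    using \<sigma> by (simp add: e inj_eq)
  define f where "f = (\<lambda>y i. cinner y (e i) *\<^sub>C e (\<sigma> i))"
  have norm_f: "(norm (sum (f y) F))\<^sup>2 = (\<Sum>i\<in>F. (cmod (cinner y (e i)))\<^sup>2)" if "finite F" for F y
    unfolding f_def using norm_sum_orthonormal[of "\<lambda>i. e (\<sigma> i)", OF e\<sigma> that] .
  have summable: "summable (f y)" for y
  proof -
    have sq: "summable (\<lambda>i. (cmod (cinner y (e i)))\<^sup>2)"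
      by (rule summableI_nonneg_bounded[of _ "(norm y)\<^sup>2"]) (simp_all add: bessel_inequality[OF e])
    show ?thesis
      unfolding summable_Cauchy
    proof (intro allI impI)
      fix r :: real assume r: "0 < r"
      then have "0 < r\<^sup>2" by simp
      with sq obtain N where N: "\<And>m n. m \<ge> N \<Longrightarrow> norm (\<Sum>i = m..<n. (cmod (cinner y (e i)))\<^sup>2) < r\<^sup>2"
        unfolding summable_Cauchy by blast
      have "norm (sum (f y) {m..<n}) < r" if "m \<ge> N" for m n
      proof (rule power2_less_imp_less)
        show "(norm (sum (f y) {m..<n}))\<^sup>2 < r\<^sup>2"
          using N[OF that, of n] by (simp add: norm_f)
      qed (use r in simp)
      then show "\<exists>N. \<forall>m\<ge>N. \<forall>n. norm (sum (f y) {m..<n}) < r" by blast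
    qed
  qed
  have bound: "norm (suminf (f y)) \<le> 1 * norm y" for y
  proof (rule LIMSEQ_le_const2)
    show "(\<lambda>n. norm (sum (f y) {..<n})) \<longlonglongrightarrow> norm (suminf (f y))"
      by (intro tendsto_norm summable_LIMSEQ summable)
    have "norm (sum (f y) {..<n}) \<le> norm y" for n
      by (rule power2_le_imp_le) (simp_all add: norm_f bessel_inequality[OF e])
    then show "\<exists>N. \<forall>n\<ge>N. norm (sum (f y) {..<n}) \<le> 1 * norm y" by simp
  qed
  have apply_S: "bop_apply (bop_of (\<lambda>y. suminf (f y))) = (\<lambda>y. suminf (f y))"
  proof (rule bop_apply_bop_of[OF _ _ bound])
    show "suminf (f (x + y)) = suminf (f x) + suminf (f y)" for x y
      unfolding suminf_add[OF summable summable]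
      by (simp add: f_def cinner_add_left scaleC_add_left)
    show "suminf (f (c *\<^sub>C x)) = c *\<^sub>C suminf (f x)" for c x
      unfolding bounded_linear.suminf[OF bounded_linear_scaleC summable]
      by (simp add: f_def cinner_scaleC_left scaleC_scaleC)
  qed
  have "suminf (f (e j)) = e (\<sigma> j)" for j
  proof -
    have "suminf (f (e j)) = sum (f (e j)) {j}"
      by (rule suminf_finite) (auto simp: f_def e)
    then show ?thesis by (simp add: f_def e scaleC_one)
  qed
  moreover have "norm (bop_of (\<lambda>y. suminf (f y))) \<le> 1"
    by (rule norm_bop_bound) (use bound in \<open>simp_all add: apply_S\<close>)
  ultimately show ?thesis by (intro exI[of _ "bop_of (\<lambda>y. suminf (f y))"]) (simp add: apply_S)
qed

text \<open>
  Totality is used twice: to get that \<open>A\<close> vanishes on the basis, and then, without continuity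
  arguments, that the adjoint of \<open>A\<close> vanishes.
\<close>

lemma bop_eq_0_if_matrix_0:
  assumes "total_set (range e)" "\<And>i j. cinner (bop_apply A (e i)) (e j) = 0"
  shows "A = 0"
proof -
  have total: "y = 0" if "\<And>i. cinner y (e i) = 0" for y
    using assms(1)[unfolded total_set_def, rule_format, of y] that by auto
  have "bop_apply A (e i) = 0" for i
    by (rule total) (rule assms(2))
  then have "cinner (bop_apply (star A) y) (e i) = 0" for y i
    by (simp add: cinner_star_left)
  then have "bop_apply (star A) y = 0" for y
    by (rule total)
  then have "star A = 0" by (intro bop_eqI) simp
  then have "norm A = 0" by (metis norm_star norm_zero)
  then show ?thesis by simp
qed

text \<open>
  The isometries are the shifts along injections of \<open>\<nat>\<close> into itself with disjoint ranges.
\<close>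

lemma exists_isometries_orthogonal_ranges:
  assumes sep: "separable_space (euclidean :: 'h::complex_hilbert_space topology)"
    and inf: "\<not> (\<exists>B::'h::complex_hilbert_space set. finite B \<and> cspan B = UNIV)"
  obtains S :: "nat \<Rightarrow> 'h::complex_hilbert_space bop"
  where "\<And>i. norm (S i) \<le> 1" "\<And>i. star (S i) * S i = bop_id"
    "\<And>i j. i \<noteq> j \<Longrightarrow> star (S i) * S j = 0"
proof -
  obtain e :: "nat \<Rightarrow> 'h" where e: "\<And>i j. cinner (e i) (e j) = (if i = j then 1 else 0)"
    and total: "total_set (range e)"
    using exists_orthonormal_basis[OF sep inf] by blast
  have "inj (\<lambda>n. prod_encode (i, n))" for i by (auto simp: inj_def)
  then have "\<exists>S. norm S \<le> 1 \<and> (\<forall>n. bop_apply S (e n) = e (prod_encode (i, n)))" for i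
    by (intro exists_shift_operator e)
  then obtain S where S: "\<And>i. norm (S i) \<le> 1"
    and S_e: "\<And>i n. bop_apply (S i) (e n) = e (prod_encode (i, n))" by metis
  show ?thesis
  proof
    show "norm (S i) \<le> 1" for i by (rule S)
    have "star (S i) * S i - bop_id = 0" for i
      by (rule bop_eq_0_if_matrix_0[OF total])
        (simp add: cinner_diff_left cinner_star_left S_e e)
    then show "star (S i) * S i = bop_id" for i by simp
    show "star (S i) * S j = 0" if "i \<noteq> j" for i j
      by (rule bop_eq_0_if_matrix_0[OF total]) (use that in \<open>auto simp: cinner_star_left S_e e\<close>)
  qed
qed

section \<open>Limits along a free filter\<close>

text \<open>
  Only the limits of the bounded complex sequences matter, so instead of an ultrafilter one can use
  a cluster point: the points \<open>n \<mapsto> (a n)\<^sub>a\<close> of a product of discs, indexed by all bounded sequences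
  \<open>a\<close>, accumulate somewhere by the theorem of Tychonoff, and the filter collects the \<open>n\<close> whose points
  are near the accumulation point.
\<close>

lemma exists_free_limit_filter:
  "\<exists>G::nat filter. G \<noteq> bot \<and> G \<le> sequentially \<and> (\<forall>a::nat \<Rightarrow>\<^sub>C complex. \<exists>l. (apply_bcontfun a \<longlongrightarrow> l) G)"
proof -
  define K where "K = (\<Pi>\<^sub>E a\<in>UNIV. cball 0 (norm (a :: nat \<Rightarrow>\<^sub>C complex)) :: complex set)"
  define h where "h = (\<lambda>n (a :: nat \<Rightarrow>\<^sub>C complex). apply_bcontfun a n)"
  have "compactin (product_topology (\<lambda>_. euclidean) UNIV) K"
    unfolding K_def by (subst compactin_PiE) simp
  then have "compact K" by (simp add: euclidean_product_topology)
  moreover have "eventually (\<lambda>x. x \<in> K) (filtermap h sequentially)"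
    unfolding eventually_filtermap
    by (intro always_eventually allI) (simp add: K_def h_def norm_bounded PiE_iff)
  moreover have "filtermap h sequentially \<noteq> bot" by (simp add: filtermap_bot_iff)
  ultimately obtain x where x: "inf (nhds x) (filtermap h sequentially) \<noteq> bot"
    unfolding compact_filter by blast
  define G where "G = inf sequentially (filtercomap h (nhds x))"
  have "G \<noteq> bot"
  proof
    assume "G = bot"
    then have "eventually (\<lambda>_. False) G" by simp
    then obtain Q R where Q: "eventually Q sequentially" and R: "eventually R (nhds x)"
      and QR: "\<And>n. Q n \<Longrightarrow> R (h n) \<Longrightarrow> False"
      unfolding G_def eventually_inf eventually_filtercomap by blast
    have "eventually (\<lambda>n. \<not> R (h n)) sequentially"
      using Q by (rule eventually_mono) (use QR in blast)
    then have "eventually (\<lambda>y. \<not> R y) (filtermap h sequentially)" by (simp add: eventually_filtermap)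
    with R have "eventually (\<lambda>_. False) (inf (nhds x) (filtermap h sequentially))"
      unfolding eventually_inf by blast
    with x show False by (simp add: trivial_limit_def)
  qed
  moreover have "G \<le> sequentially" by (simp add: G_def)
  moreover have "(apply_bcontfun a \<longlongrightarrow> x a) G" for a
  proof -
    have "(h \<longlongrightarrow> x) G"
      by (rule tendsto_mono[OF _ filterlim_filtercomap]) (simp add: G_def)
    from continuous_on_tendsto_compose[OF continuous_on_product_coordinates[of a] this]
    have "((\<lambda>n. h n a) \<longlongrightarrow> x a) G" by simp
    then show ?thesis by (simp add: h_def)
  qed
  ultimately show ?thesis by blast
qed

section \<open>Evaluation of the tensor product at infinity\<close>

lemma tensor_lift_superset:
  assumes "finite S" "Poly_Mapping.keys p \<subseteq> S"
  shows "tensor_lift \<tau> p = (\<Sum>(a, b)\<in>S. Poly_Mapping.lookup p (a, b) *\<^sub>C \<tau> a b)"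
  unfolding tensor_lift_def
  using assms by (intro sum.mono_neutral_left) (auto simp: in_keys_iff)

lemma tensor_lift_add: "tensor_lift \<tau> (p + q) = tensor_lift \<tau> p + tensor_lift \<tau> q"
proof -
  define S where "S = Poly_Mapping.keys p \<union> Poly_Mapping.keys q"
  have "finite S" by (simp add: S_def)
  moreover have "Poly_Mapping.keys (p + q) \<subseteq> S" "Poly_Mapping.keys p \<subseteq> S" "Poly_Mapping.keys q \<subseteq> S"
    using keys_add[of p q] by (auto simp: S_def)
  ultimately show ?thesis
    by (simp add: tensor_lift_superset[of S] lookup_add scaleC_add_left case_prod_unfold sum.distrib)
qed

lemma tensor_lift_scale:
  "tensor_lift \<tau> (Poly_Mapping.map ((*) c) p) = c *\<^sub>C tensor_lift \<tau> p"
proof -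
  have lookup: "Poly_Mapping.lookup (Poly_Mapping.map ((*) c) p) x = c * Poly_Mapping.lookup p x" for x
    by (simp add: Poly_Mapping.map.rep_eq when_def)
  then have "Poly_Mapping.keys (Poly_Mapping.map ((*) c) p) \<subseteq> Poly_Mapping.keys p"
    by (auto simp: in_keys_iff)
  then show ?thesis
    by (simp add: tensor_lift_superset[of "Poly_Mapping.keys p"] lookup case_prod_unfold
        complex_vector.scale_sum_right scaleC_scaleC)
qed

lemma tensor_lift_diff: "tensor_lift \<tau> (p - q) = tensor_lift \<tau> p - tensor_lift \<tau> q"
  using tensor_lift_add[of \<tau> "p - q" q] by simp

lemma tensor_lift_single: "tensor_lift \<tau> (Poly_Mapping.single (a, b) c) = c *\<^sub>C \<tau> a b"
  by (cases "c = 0") (simp_all add: tensor_lift_def)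

lemma clinear_tensor_lift:
  assumes f: "clinear f"
  shows "f (tensor_lift \<tau> p) = tensor_lift (\<lambda>a b. f (\<tau> a b)) p"
proof -
  have sum: "f (sum g S) = (\<Sum>x\<in>S. f (g x))" for g S
    by (induction S rule: infinite_finite_induct) (simp_all add: clinear_zero[OF f] clinear_add[OF f])
  show ?thesis
    by (simp add: tensor_lift_def sum case_prod_unfold clinear_scaleC[OF f])
qed

text \<open>
  Bilinear maps factor through the algebraic tensor product. Together with the injectivity of \<open>\<tau>\<close> on
  that product, this is how elementary tensors are shown not to vanish.
\<close>

lemma tensor_null_tensor_lift:
  assumes "p \<in> tensor_null" "\<And>b. clinear (\<lambda>a. \<beta> a b)" "\<And>a. clinear (\<beta> a)"
  shows "tensor_lift \<beta> p = 0"
proof -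
  have lin: "\<beta> (a + a') b = \<beta> a b + \<beta> a' b" "\<beta> a (b + b') = \<beta> a b + \<beta> a b'"
    "\<beta> (c *\<^sub>C a) b = c *\<^sub>C \<beta> a b" "\<beta> a (c *\<^sub>C b) = c *\<^sub>C \<beta> a b" for a a' b b' c
    using assms(2,3) clinear_add[of "\<lambda>a. \<beta> a b" a a'] clinear_scaleC[of "\<lambda>a. \<beta> a b" c a]
      clinear_add[of "\<beta> a" b b'] clinear_scaleC[of "\<beta> a" c b] by simp_all
  from assms(1) show ?thesis
    by induction
      (simp_all add: tensor_lift_add tensor_lift_diff tensor_lift_scale tensor_lift_single lin scaleC_one,
        simp_all add: tensor_lift_def)
qed

lemma bounded_linear_scaleC_left: "bounded_linear (\<lambda>c. c *\<^sub>C (x::'a::complex_normed_vector))"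
  by (rule bounded_linear_intro[of _ "norm x"])
    (simp_all add: scaleC_add_left norm_scaleC scaleR_scaleC scaleR_conv_of_real scaleC_scaleC)

lemma tendsto_tensor_lift:
  fixes \<tau> :: "'i \<Rightarrow> 'a \<Rightarrow> 'b \<Rightarrow> 't::complex_normed_vector"
  assumes "\<And>a b. ((\<lambda>i. \<tau> i a b) \<longlongrightarrow> \<tau>' a b) G"
  shows "((\<lambda>i. tensor_lift (\<tau> i) p) \<longlongrightarrow> tensor_lift \<tau>' p) G"
  unfolding tensor_lift_def case_prod_unfold
  by (intro tendsto_sum bounded_linear.tendsto[OF bounded_linear_scaleC] assms)

definition unit_seq :: "nat \<Rightarrow> (nat \<Rightarrow>\<^sub>C complex)"
  where "unit_seq n = Bcontfun (\<lambda>k. if k = n then 1 else 0)"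

lemma apply_unit_seq [simp]: "unit_seq n k = (if k = n then 1 else 0)"
proof -
  have "(\<lambda>k. if k = n then 1 else 0 :: complex) \<in> bcontfun"
    unfolding bcontfun_nat by (auto intro!: boundedI[of _ 1])
  then show ?thesis by (simp add: unit_seq_def Bcontfun_inverse)
qed

lemma unit_seq_mult: "unit_seq n * a = a n *\<^sub>C unit_seq n"
  by (rule bcontfun_eqI) simp

lemma mult_unit_seq: "a * unit_seq n = a n *\<^sub>C unit_seq n"
  by (rule bcontfun_eqI) simp

lemma star_unit_seq: "star (unit_seq n) = unit_seq n"
  by (rule bcontfun_eqI) simp

lemma apply_const_bcontfun [simp]: "apply_bcontfun (const_bcontfun c) x = c"
  by (simp add: const_bcontfun.rep_eq)

context
  fixes \<tau> :: "(nat \<Rightarrow>\<^sub>C complex) \<Rightarrow> 'h::complex_hilbert_space bop \<Rightarrow> 't::cstar_algebra"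
  assumes tensor: "cstar_tensor_product \<tau>"
begin

lemma tau_clinear: "clinear (\<lambda>a. \<tau> a b)" "clinear (\<tau> a)"
  and tau_mult: "\<tau> a b * \<tau> a' b' = \<tau> (a * a') (b * b')"
  and tau_star: "star (\<tau> a b) = \<tau> (star a) (star b)"
  and tau_inj: "tensor_lift \<tau> p = 0 \<Longrightarrow> p \<in> tensor_null"
  and tau_dense: "closure (range (tensor_lift \<tau>)) = UNIV"
  using tensor unfolding cstar_tensor_product_def by blast+

lemmas tau_simps = clinear_add[OF tau_clinear(1)] clinear_add[OF tau_clinear(2)]
  clinear_scaleC[OF tau_clinear(1)] clinear_scaleC[OF tau_clinear(2)]

lemma tensor_approximation:
  obtains p where "(\<lambda>k. tensor_lift \<tau> (p k)) \<longlonglongrightarrow> t"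
proof -
  have "t \<in> closure (range (tensor_lift \<tau>))" by (simp add: tau_dense)
  then obtain u where u: "\<And>k. u k \<in> range (tensor_lift \<tau>)" "u \<longlonglongrightarrow> t"
    unfolding closure_sequential by blast
  then have "\<forall>k. \<exists>p. u k = tensor_lift \<tau> p" by blast
  then obtain p where "\<And>k. u k = tensor_lift \<tau> (p k)" by metis
  then have "u = (\<lambda>k. tensor_lift \<tau> (p k))" by blast
  with u(2) show ?thesis by (auto intro: that)
qed

lemma tensor_dense_induct [case_names closed add scaleC tau]:
  assumes closed: "closed {t. P t}"
    and add: "\<And>s t. P s \<Longrightarrow> P t \<Longrightarrow> P (s + t)"
    and scale: "\<And>c t. P t \<Longrightarrow> P (c *\<^sub>C t)"
    and tau: "\<And>a b. P (\<tau> a b)"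
  shows "P t"
proof -
  have sum: "P (\<Sum>x\<in>S. g x)" if "\<And>x. P (g x)" for g and S :: "((nat \<Rightarrow>\<^sub>C complex) \<times> 'h bop) set"
    using that scale[OF tau, of 0]
    by (induction S rule: infinite_finite_induct) (auto intro: add)
  have "P (tensor_lift \<tau> p)" for p
    unfolding tensor_lift_def case_prod_unfold by (intro sum scale tau)
  then have "closure (range (tensor_lift \<tau>)) \<subseteq> {t. P t}"
    by (intro closure_minimal closed) blast
  then show ?thesis by (auto simp: tau_dense)
qed

text \<open>
  The central projection of the tensor product that cuts out the coordinate \<open>n\<close>.
\<close>

definition slot :: "nat \<Rightarrow> 't"
  where "slot n = \<tau> (unit_seq n) bop_id"

lemma slot_mult_tau: "slot n * \<tau> a b = \<tau> (unit_seq n) (a n *\<^sub>C b)"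
  and tau_mult_slot: "\<tau> a b * slot n = \<tau> (unit_seq n) (a n *\<^sub>C b)"
  by (simp_all add: slot_def tau_mult unit_seq_mult mult_unit_seq tau_simps)

lemma slot_central: "slot n * t = t * slot n"
proof (induction t rule: tensor_dense_induct)
  case closed
  then show ?case by (intro closed_Collect_eq continuous_intros)
qed (simp_all add: distrib_left distrib_right scaleC_mult_left scaleC_mult_right
    slot_mult_tau tau_mult_slot)

lemma slot_orthogonal: "slot m * slot n = (if m = n then slot n else 0)"
proof -
  have "slot m * slot n = \<tau> (unit_seq m) (unit_seq n m *\<^sub>C bop_id)"
    by (simp add: slot_mult_tau slot_def[of n])
  then show ?thesis by (simp add: slot_def clinear_zero[OF tau_clinear(2)])
qed

lemma norm_slot_le: "norm (slot n) \<le> 1"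
proof -
  have "star (slot n) = slot n" by (simp add: slot_def tau_star star_unit_seq)
  then have "(norm (slot n))\<^sup>2 = norm (slot n)"
    using norm_star_mult[of "slot n"] by (simp add: slot_orthogonal)
  then show ?thesis by (cases "norm (slot n) = 0") (auto simp: power2_eq_square)
qed

lemma tensor_unit:
  "\<tau> (const_bcontfun 1) bop_id * t = t" "t * \<tau> (const_bcontfun 1) bop_id = t"
proof -
  have "const_bcontfun 1 * a = a" "a * const_bcontfun 1 = a" for a :: "nat \<Rightarrow>\<^sub>C complex"
    by (rule bcontfun_eqI, simp)+
  then have unit: "\<tau> (const_bcontfun 1) bop_id * \<tau> a b = \<tau> a b"
    "\<tau> a b * \<tau> (const_bcontfun 1) bop_id = \<tau> a b" for a b
    by (simp_all add: tau_mult)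
  show "\<tau> (const_bcontfun 1) bop_id * t = t"
  proof (induction t rule: tensor_dense_induct)
    case closed
    show ?case by (intro closed_Collect_eq continuous_intros)
  qed (simp_all add: distrib_left scaleC_mult_right unit)
  show "t * \<tau> (const_bcontfun 1) bop_id = t"
  proof (induction t rule: tensor_dense_induct)
    case closed
    show ?case by (intro closed_Collect_eq continuous_intros)
  qed (simp_all add: distrib_right scaleC_mult_left unit)
qed

text \<open>
  The coordinate \<open>n\<close> of an element of the algebraic tensor product is an operator \<open>B\<close> with
  \<open>slot n * tensor_lift \<tau> p = \<tau> (unit_seq n) B\<close>, and \<open>B \<mapsto> \<tau> (unit_seq n) B\<close> is an injective
  *-homomorphism, so the minimality of the operator norm applies.
\<close>

lemma norm_slot_component_le:
  "norm (tensor_lift (\<lambda>a b. apply_bcontfun a n *\<^sub>C b) p) \<le> norm (slot n * tensor_lift \<tau> p)"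
proof -
  let ?B = "tensor_lift (\<lambda>a b. apply_bcontfun a n *\<^sub>C b) p"
  have inj: "B = 0" if "\<tau> (unit_seq n) B = 0" for B
  proof -
    have "tensor_lift \<tau> (Poly_Mapping.single (unit_seq n, B) 1) = 0"
      using that by (simp add: tensor_lift_single)
    then have "Poly_Mapping.single (unit_seq n, B) 1 \<in> tensor_null" by (rule tau_inj)
    then have "tensor_lift (\<lambda>a b. apply_bcontfun a n *\<^sub>C b) (Poly_Mapping.single (unit_seq n, B) 1) = 0"
      by (rule tensor_null_tensor_lift)
        (auto intro!: clinearI simp: scaleC_add_left scaleC_add_right scaleC_scaleC mult.commute)
    then show ?thesis by (simp add: tensor_lift_single scaleC_one)
  qed
  have mult: "\<tau> (unit_seq n) (A * B) = \<tau> (unit_seq n) A * \<tau> (unit_seq n) B" for A B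
    by (simp add: tau_mult unit_seq_mult scaleC_one)
  have "norm ?B \<le> norm (\<tau> (unit_seq n) ?B)"
    by (rule norm_le_norm_star_embedding)
      (simp_all add: mult tau_star star_unit_seq tau_simps inj)
  also have "\<tau> (unit_seq n) ?B = slot n * tensor_lift \<tau> p"
  proof -
    have "clinear (\<lambda>t. slot n * t)"
      by (intro clinearI) (simp_all add: distrib_left scaleC_mult_right)
    then show ?thesis
      by (simp add: clinear_tensor_lift[OF tau_clinear(2)] clinear_tensor_lift slot_mult_tau)
  qed
  finally show ?thesis .
qed

text \<open>
  On the algebraic tensor product the evaluation is the limit of the coordinates along a free
  filter. As each coordinate is bounded by its slot, the value at \<open>u\<close> is bounded by the norm
  of \<open>slot n * u\<close> for large \<open>n\<close>; this gives first a well-defined contraction, which extends by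
  uniform continuity, and then the vanishing on elements with only finitely many nonzero slots.
\<close>

lemma exists_evaluation_at_infinity:
  obtains ev :: "'t \<Rightarrow> 'h bop"
  where "clinear ev" "\<And>s t. ev (s * t) = ev s * ev t"
    "ev (\<tau> (const_bcontfun 1) bop_id) = bop_id"
    "\<And>t. eventually (\<lambda>n. slot n * t = 0) sequentially \<Longrightarrow> ev t = 0"
proof -
  obtain G :: "nat filter" where G: "G \<noteq> bot" "G \<le> sequentially"
    and "\<And>a::nat \<Rightarrow>\<^sub>C complex. \<exists>l. (apply_bcontfun a \<longlongrightarrow> l) G"
    using exists_free_limit_filter by blast
  then obtain \<Lambda> where \<Lambda>: "\<And>a::nat \<Rightarrow>\<^sub>C complex. (apply_bcontfun a \<longlongrightarrow> \<Lambda> a) G" by metis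
  have \<Lambda>_eq: "\<Lambda> a = l" if "(apply_bcontfun a \<longlongrightarrow> l) G" for a l
    using tendsto_unique[OF G(1) \<Lambda> that] .
  define L where "L = tensor_lift (\<lambda>a b. \<Lambda> a *\<^sub>C b :: 'h bop)"
  have norm_L: "norm (L p) \<le> C"
    if "eventually (\<lambda>n. norm (slot n * tensor_lift \<tau> p) \<le> C) sequentially" for p C
  proof (rule tendsto_upperbound[OF _ _ G(1)])
    show "((\<lambda>n. norm (tensor_lift (\<lambda>a b. apply_bcontfun a n *\<^sub>C b) p)) \<longlongrightarrow> norm (L p)) G"
      unfolding L_def
      by (intro tendsto_norm tendsto_tensor_lift bounded_linear.tendsto[OF bounded_linear_scaleC_left] \<Lambda>)
    show "eventually (\<lambda>n. norm (tensor_lift (\<lambda>a b. apply_bcontfun a n *\<^sub>C b) p) \<le> C) G"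
      using filter_leD[OF G(2) that]
      by (rule eventually_mono) (rule order_trans[OF norm_slot_component_le])
  qed
  have slot_le: "norm (slot n * t) \<le> norm t" for n t
  proof -
    have "norm (slot n * t) \<le> norm (slot n) * norm t" by (rule norm_mult_ineq)
    also have "\<dots> \<le> 1 * norm t" by (intro mult_right_mono norm_slot_le) simp
    finally show ?thesis by simp
  qed
  have contr: "norm (L p - L q) \<le> norm (tensor_lift \<tau> p - tensor_lift \<tau> q)" for p q
  proof -
    have "norm (L (p - q)) \<le> norm (tensor_lift \<tau> (p - q))"
      by (intro norm_L always_eventually allI slot_le)
    then show ?thesis by (simp add: L_def tensor_lift_diff)
  qed
  \<comment> \<open>by the contraction estimate, the choice of the representative \<open>p\<close> does not matter\<close>
  define ev\<^sub>0 where "ev\<^sub>0 = (\<lambda>u. L (SOME p. tensor_lift \<tau> p = u))"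
  have ev\<^sub>0: "ev\<^sub>0 (tensor_lift \<tau> p) = L p" for p
  proof -
    have "tensor_lift \<tau> (SOME q. tensor_lift \<tau> q = tensor_lift \<tau> p) = tensor_lift \<tau> p"
      by (rule someI) (rule refl)
    with contr[of "SOME q. tensor_lift \<tau> q = tensor_lift \<tau> p" p] show ?thesis
      by (simp add: ev\<^sub>0_def)
  qed
  have "uniformly_continuous_on (range (tensor_lift \<tau>)) ev\<^sub>0"
    unfolding uniformly_continuous_on_def
  proof (intro allI impI)
    fix r :: real assume "r > 0"
    moreover have "dist (ev\<^sub>0 v) (ev\<^sub>0 u) \<le> dist v u"
      if "u \<in> range (tensor_lift \<tau>)" "v \<in> range (tensor_lift \<tau>)" for u v
      using that contr by (auto simp: ev\<^sub>0 dist_norm)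
    ultimately show "\<exists>d>0. \<forall>u\<in>range (tensor_lift \<tau>). \<forall>v\<in>range (tensor_lift \<tau>).
        dist v u < d \<longrightarrow> dist (ev\<^sub>0 v) (ev\<^sub>0 u) < r"
      by (meson le_less_trans)
  qed
  then obtain ev where "uniformly_continuous_on UNIV ev"
    and "\<And>u. u \<in> range (tensor_lift \<tau>) \<Longrightarrow> ev\<^sub>0 u = ev u"
    by (rule uniformly_continuous_on_extension_on_closure) (auto simp: tau_dense)
  then have cont: "continuous_on UNIV ev" and ev: "\<And>p. ev (tensor_lift \<tau> p) = L p"
    by (auto simp: uniformly_continuous_imp_continuous simp flip: ev\<^sub>0)
  have lim: "(\<lambda>k. L (p k)) \<longlonglongrightarrow> ev t" if "(\<lambda>k. tensor_lift \<tau> (p k)) \<longlonglongrightarrow> t" for p t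
    using continuous_on_tendsto_compose[OF cont that] by (simp add: ev)
  have ev_tau: "ev (\<tau> a b) = \<Lambda> a *\<^sub>C b" for a b
    using ev[of "Poly_Mapping.single (a, b) 1"] by (simp add: L_def tensor_lift_single scaleC_one)
  have ev_add: "ev (s + t) = ev s + ev t" for s t
  proof -
    obtain p q where pq: "(\<lambda>k. tensor_lift \<tau> (p k)) \<longlonglongrightarrow> s" "(\<lambda>k. tensor_lift \<tau> (q k)) \<longlonglongrightarrow> t"
      using tensor_approximation by metis
    have "(\<lambda>k. L (p k + q k)) \<longlonglongrightarrow> ev (s + t)"
      using tendsto_add[OF pq] by (intro lim) (simp add: tensor_lift_add)
    moreover have "(\<lambda>k. L (p k + q k)) \<longlonglongrightarrow> ev s + ev t"
      using tendsto_add[OF lim[OF pq(1)] lim[OF pq(2)]] by (simp add: L_def tensor_lift_add)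
    ultimately show ?thesis by (rule LIMSEQ_unique)
  qed
  have ev_scale: "ev (c *\<^sub>C t) = c *\<^sub>C ev t" for c t
  proof -
    obtain p where p: "(\<lambda>k. tensor_lift \<tau> (p k)) \<longlonglongrightarrow> t" using tensor_approximation by blast
    have "(\<lambda>k. L (Poly_Mapping.map ((*) c) (p k))) \<longlonglongrightarrow> ev (c *\<^sub>C t)"
      using bounded_linear.tendsto[OF bounded_linear_scaleC p, of c]
      by (intro lim) (simp add: tensor_lift_scale)
    moreover have "(\<lambda>k. L (Poly_Mapping.map ((*) c) (p k))) \<longlonglongrightarrow> c *\<^sub>C ev t"
      using bounded_linear.tendsto[OF bounded_linear_scaleC lim[OF p], of c]
      by (simp add: L_def tensor_lift_scale)
    ultimately show ?thesis by (rule LIMSEQ_unique)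
  qed
  note cont' = continuous_on_compose2[OF cont _ subset_UNIV]
  have \<Lambda>_mult: "\<Lambda> (a * b) = \<Lambda> a * \<Lambda> b" for a b
    using tendsto_mult[OF \<Lambda>[of a] \<Lambda>[of b]] by (intro \<Lambda>_eq) simp
  have ev_mult_tau: "ev (\<tau> a b * t) = ev (\<tau> a b) * ev t" for a b t
  proof (induction t rule: tensor_dense_induct)
    case closed
    show ?case by (intro closed_Collect_eq continuous_intros cont')
  qed (simp_all add: distrib_left scaleC_mult_right ev_add ev_scale tau_mult ev_tau \<Lambda>_mult
      scaleC_mult_left scaleC_scaleC)
  have ev_mult: "ev (s * t) = ev s * ev t" for s t
  proof (induction s rule: tensor_dense_induct)
    case closed
    show ?case by (intro closed_Collect_eq continuous_intros cont')
  qed (simp_all add: distrib_right scaleC_mult_left ev_add ev_scale ev_mult_tau)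
  have ev_unit: "ev (\<tau> (const_bcontfun 1) bop_id) = bop_id"
    by (simp add: ev_tau \<Lambda>_eq[of _ 1] scaleC_one)
  have ev_zero: "ev t = 0" if t: "eventually (\<lambda>n. slot n * t = 0) sequentially" for t
  proof -
    obtain p where p: "(\<lambda>k. tensor_lift \<tau> (p k)) \<longlonglongrightarrow> t" using tensor_approximation by blast
    have "norm (L (p k)) \<le> norm (tensor_lift \<tau> (p k) - t)" for k
    proof (rule norm_L)
      show "eventually (\<lambda>n. norm (slot n * tensor_lift \<tau> (p k)) \<le> norm (tensor_lift \<tau> (p k) - t)) sequentially"
        using t
      proof (rule eventually_mono)
        fix n assume "slot n * t = 0"
        then show "norm (slot n * tensor_lift \<tau> (p k)) \<le> norm (tensor_lift \<tau> (p k) - t)"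
          using slot_le[of n "tensor_lift \<tau> (p k) - t"] by (simp add: right_diff_distrib)
      qed
    qed
    moreover have "(\<lambda>k. norm (tensor_lift \<tau> (p k) - t)) \<longlonglongrightarrow> 0"
      by (rule tendsto_norm_zero[OF LIM_zero[OF p]])
    ultimately have "(\<lambda>k. L (p k)) \<longlonglongrightarrow> 0"
      by (rule Lim_null_comparison[OF always_eventually[OF allI]])
    with lim[OF p] show ?thesis by (rule LIMSEQ_unique)
  qed
  show ?thesis
    using that[OF clinearI[OF ev_add ev_scale] ev_mult ev_unit ev_zero] .
qed

end

section \<open>Jordan homomorphisms of bounded sequences of operators\<close>

text \<open>
  Choose a unit vector \<open>v i\<close> in the range of each idempotent. If \<open>i \<noteq> j\<close>, then \<open>z i\<close> maps \<open>v i - v j\<close> to the unit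
  vector \<open>v i\<close>, so the distance of the two vectors is at least the inverse of the smaller one of
  the norms of \<open>z i\<close> and \<open>z j\<close>. These norms may be unbounded over the family, whence
  the radii below depend on the index.
\<close>

lemma countable_orthogonal_idempotents:
  fixes z :: "'i \<Rightarrow> 'h::complex_hilbert_space bop"
  assumes sep: "separable_space (euclidean :: 'h topology)"
    and idem: "\<And>i. i \<in> I \<Longrightarrow> z i * z i = z i"
    and nonzero: "\<And>i. i \<in> I \<Longrightarrow> z i \<noteq> 0"
    and orth: "\<And>i j. i \<in> I \<Longrightarrow> j \<in> I \<Longrightarrow> i \<noteq> j \<Longrightarrow> z i * z j = 0"
  shows "countable I"
proof -
  have "\<exists>v. norm v = 1 \<and> bop_apply (z i) v = v" if i: "i \<in> I" for i
  proof -
    obtain y where y: "bop_apply (z i) y \<noteq> 0"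
      using nonzero[OF i] by (metis bop_apply_simps(1) bop_eqI)
    define w where "w = bop_apply (z i) y"
    have "bop_apply (z i) w = w" unfolding w_def using idem[OF i] by (metis bop_apply_times)
    then have "bop_apply (z i) (complex_of_real (inverse (norm w)) *\<^sub>C w)
        = complex_of_real (inverse (norm w)) *\<^sub>C w"
      by (simp only: bop_apply_scaleC)
    moreover have "norm (complex_of_real (inverse (norm w)) *\<^sub>C w) = 1"
      using y by (simp add: norm_scaleC norm_inverse w_def)
    ultimately show ?thesis by blast
  qed
  then obtain v where v: "\<And>i. i \<in> I \<Longrightarrow> norm (v i) = 1" "\<And>i. i \<in> I \<Longrightarrow> bop_apply (z i) (v i) = v i"
    using bchoice[of I "\<lambda>i v. norm v = 1 \<and> bop_apply (z i) v = v"] by blast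
  define r where "r = (\<lambda>i. 1 / (norm (z i) + 1) / 2)"
  have r: "r i > 0" for i by (simp add: r_def add_nonneg_pos)
  have far: "r i + r j \<le> dist (v i) (v j)"
    if ij: "i \<in> I" "j \<in> I" "i \<noteq> j" "norm (z i) \<le> norm (z j)" for i j
  proof -
    have "bop_apply (z i) (v j) = bop_apply (z i * z j) (v j)" using v(2)[OF ij(2)] by simp
    then have "bop_apply (z i) (v j) = 0" by (simp add: orth ij)
    moreover have "bop_apply (z i) (v i) = bop_apply (z i) (v i - v j) + bop_apply (z i) (v j)"
      by (simp flip: bop_apply_add)
    ultimately have "bop_apply (z i) (v i - v j) = v i" using v(2)[OF ij(1)] by simp
    then have "1 \<le> norm (z i) * dist (v i) (v j)"
      using norm_bop_apply[of "z i" "v i - v j"] v(1)[OF ij(1)] by (simp add: dist_norm)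
    also have "\<dots> \<le> (norm (z i) + 1) * dist (v i) (v j)" by (intro mult_right_mono) auto
    finally have "1 / (norm (z i) + 1) \<le> dist (v i) (v j)"
      by (simp add: divide_le_eq add_nonneg_pos mult.commute)
    moreover have "r j \<le> r i"
      unfolding r_def using ij(4) by (intro divide_right_mono divide_left_mono) (auto simp: add_nonneg_pos)
    moreover have "r i + r i = 1 / (norm (z i) + 1)"
      unfolding r_def by (rule field_sum_of_halves)
    ultimately show ?thesis by linarith
  qed
  show ?thesis
  proof (rule countable_if_separated[OF sep r])
    fix i j assume ij: "i \<in> I" "j \<in> I" "i \<noteq> j"
    show "r i + r j \<le> dist (v i) (v j)"
      using far[of i j] far[of j i] ij by (cases "norm (z i) \<le> norm (z j)") (auto simp: dist_commute add.commute)
  qed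
qed

lemma uncountable_UNIV_nat_set: "\<not> countable (UNIV :: nat set set)"
proof
  assume "countable (UNIV :: nat set set)"
  then have "range (from_nat_into (UNIV :: nat set set)) = UNIV"
    by (intro range_from_nat_into) auto
  then show False using Cantors_theorem[of "UNIV :: nat set"] by (simp add: Pow_UNIV)
qed

text \<open>
  Two sets \<open>A\<close> and \<open>B\<close> of natural numbers that differ have different intersections with \<open>{..<n}\<close> for all large
  \<open>n\<close>. Choosing at the coordinate \<open>n\<close> the isometry with the number of this intersection thus gives
  elements \<open>V A\<close> of the sequence algebra, indexed by the uncountably many sets \<open>A\<close>, whose range projections
  \<open>p A\<close> are orthogonal up to finitely many coordinates.

  The map \<open>\<Psi>\<close> cannot annihilate \<open>p A\<close>: with \<open>V = V A\<close> and \<open>p = p A\<close>, the Jordan expression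
  \<open>star V * p * V + V * p * star V\<close> is the sum of the unit and an idempotent \<open>r\<close>, so \<open>\<Psi> p = 0\<close> would make the idempotent
  \<open>\<Psi> r\<close> equal to the negative of the unit.
\<close>

lemma no_unital_jordan_homomorphism_vanishing_on_finite_sequences:
  fixes \<Psi> :: "(nat \<Rightarrow>\<^sub>C 'h::complex_hilbert_space bop) \<Rightarrow> 'h bop"
  assumes sep: "separable_space (euclidean :: 'h topology)"
    and inf: "\<not> (\<exists>B::'h set. finite B \<and> cspan B = UNIV)"
    and \<Psi>: "jordan_homomorphism \<Psi>"
    and unit: "\<Psi> (const_bcontfun bop_id) = bop_id"
    and fin: "\<And>x. eventually (\<lambda>n. apply_bcontfun x n = 0) sequentially \<Longrightarrow> \<Psi> x = 0"
  shows False
proof -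
  obtain S :: "nat \<Rightarrow> 'h bop" where S_norm: "\<And>i. norm (S i) \<le> 1"
    and S_iso: "\<And>i. star (S i) * S i = bop_id"
    and S_orth: "\<And>i j. i \<noteq> j \<Longrightarrow> star (S i) * S j = 0"
    by (rule exists_isometries_orthogonal_ranges[OF sep inf]) blast
  define V where "V = (\<lambda>A::nat set. Bcontfun (\<lambda>n. S (set_encode (A \<inter> {..<n}))))"
  have V: "apply_bcontfun (V A) n = S (set_encode (A \<inter> {..<n}))" for A n
  proof -
    have "(\<lambda>n::nat. S (set_encode (A \<inter> {..<n}))) \<in> bcontfun"
      unfolding bcontfun_nat by (auto intro!: boundedI[of _ 1] S_norm)
    then show ?thesis by (simp add: V_def Bcontfun_inverse)
  qed
  have one [simp]: "const_bcontfun bop_id * x = x" "x * const_bcontfun bop_id = x"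
    for x :: "nat \<Rightarrow>\<^sub>C 'h bop"
    by (auto intro: bcontfun_eqI)
  have V_iso: "star (V A) * V A = const_bcontfun bop_id" for A
    by (rule bcontfun_eqI) (simp add: V S_iso)
  then have V_iso': "star (V A) * (V A * x) = x" for A x
    by (simp flip: mult.assoc)
  define p where "p = (\<lambda>A. V A * star (V A))"
  have p_idem: "p A * p A = p A" for A
    by (simp add: p_def mult.assoc V_iso')
  have p_orth: "eventually (\<lambda>n. apply_bcontfun (p A * p B + p B * p A) n = 0) sequentially"
    if AB: "A \<noteq> B" for A B
  proof -
    obtain i where i: "i \<in> A \<longleftrightarrow> i \<notin> B" using AB by blast
    have zero: "star (V A n) * V B n = 0" "star (V B n) * V A n = 0" if "n > i" for n
    proof -
      have "A \<inter> {..<n} \<noteq> B \<inter> {..<n}" using i that by blast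
      then have "set_encode (A \<inter> {..<n}) \<noteq> set_encode (B \<inter> {..<n})"
        by (simp add: set_encode_eq)
      then show "star (V A n) * V B n = 0" "star (V B n) * V A n = 0"
        by (simp_all add: V S_orth)
    qed
    have "apply_bcontfun (p A * p B + p B * p A) n = 0" if "n > i" for n
    proof -
      have "(p A * p B) n = V A n * (star (V A n) * V B n) * star (V B n)"
        "(p B * p A) n = V B n * (star (V B n) * V A n) * star (V A n)"
        by (simp_all add: p_def mult.assoc)
      then show ?thesis unfolding zero[OF that] by simp
    qed
    then show ?thesis using eventually_gt_at_top[of i] by (rule eventually_mono[rotated])
  qed
  obtain x :: 'h where "x \<noteq> 0"
  proof (rule ccontr)
    assume "\<not> thesis"
    then have "x = 0" for x :: 'h using that by blast
    then have "cspan {} = (UNIV :: 'h set)" by auto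
    with inf show False by blast
  qed
  then have id_nonzero: "bop_id \<noteq> (0 :: 'h bop)"
    by (metis bop_apply_id bop_apply_simps(1))
  have p_nonzero: "\<Psi> (p A) \<noteq> 0" for A
  proof
    assume zero: "\<Psi> (p A) = 0"
    define r where "r = V A * p A * star (V A)"
    have "\<Psi> (star (V A) * p A * V A + r) = 0"
      unfolding r_def jordan_triple_polarized[OF \<Psi>] zero by simp
    moreover have "star (V A) * p A * V A = const_bcontfun bop_id"
      by (simp add: p_def mult.assoc V_iso V_iso')
    ultimately have "bop_id + \<Psi> r = 0"
      by (simp add: clinear_add[OF jordan_clinear[OF \<Psi>]] unit)
    then have r: "\<Psi> r = - bop_id" by (simp add: eq_neg_iff_add_eq_0 add.commute)
    have "r * r = r" by (simp add: r_def p_def mult.assoc V_iso')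
    with jordan_square[OF \<Psi>, of r] have "- bop_id = (bop_id :: 'h bop)" by (simp add: r)
    then have "bop_id + bop_id = 0 + (0 :: 'h bop)" by (metis add.right_inverse add_0)
    then have "bop_id = (0 :: 'h bop)" by (simp only: double_eq_iff)
    with id_nonzero show False ..
  qed
  have "\<Psi> (p A) * \<Psi> (p B) = 0" if "A \<noteq> B" for A B
  proof (rule anticommuting_idempotents_orthogonal)
    show "\<Psi> (p A) * \<Psi> (p A) = \<Psi> (p A)"
      by (simp add: p_idem flip: jordan_square[OF \<Psi>])
    show "\<Psi> (p A) * \<Psi> (p B) + \<Psi> (p B) * \<Psi> (p A) = 0"
      unfolding jordan_anticommutator[OF \<Psi>, symmetric] by (rule fin[OF p_orth[OF that]])
  qed
  then have "countable (UNIV :: nat set set)"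
    using p_nonzero
    by (intro countable_orthogonal_idempotents[OF sep, where z = "\<lambda>A. \<Psi> (p A)"])
      (simp_all add: p_idem flip: jordan_square[OF \<Psi>])
  with uncountable_UNIV_nat_set show False ..
qed

text \<open>
  The coordinates at \<open>k\<close> of two of these central elements have product zero, even with
  an arbitrary operator in between, so by primeness of \<open>B(H)\<close> one of them is zero.
\<close>

lemma eventually_orthogonal_central_vanish:
  fixes g :: "nat \<Rightarrow> (nat \<Rightarrow>\<^sub>C 'h::complex_hilbert_space bop)"
  assumes central: "\<And>n x. g n * x = x * g n"
    and orth: "\<And>m n. m \<noteq> n \<Longrightarrow> g m * g n = 0"
  shows "eventually (\<lambda>n. apply_bcontfun (g n) k = 0) sequentially"
proof (cases "\<exists>m. apply_bcontfun (g m) k \<noteq> 0")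
  case True
  then obtain m where m: "apply_bcontfun (g m) k \<noteq> 0" by blast
  have "apply_bcontfun (g n) k = 0" if "n > m" for n
  proof -
    have "g m k * R * g n k = 0" for R
    proof -
      have "g m * const_bcontfun R * g n = const_bcontfun R * (g m * g n)"
        by (simp only: central[of m "const_bcontfun R"] mult.assoc)
      also have "\<dots> = 0" using that by (simp add: orth)
      finally have "(g m * const_bcontfun R * g n) k = 0" by simp
      then show ?thesis by simp
    qed
    with bop_prime m show ?thesis by blast
  qed
  then show ?thesis using eventually_gt_at_top[of m] by (rule eventually_mono[rotated])
qed simp

text \<open>
  Here \<open>g n\<close> is the preimage of the coordinate projection \<open>slot \<tau> n\<close>. If \<open>x\<close> has finite support,
  then \<open>g n * x = 0\<close> for large \<open>n\<close>, hence \<open>\<theta> x\<close> has only finitely many nonzero slots and vanishes at infinity.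
\<close>

lemma no_jordan_isomorphism_bounded_sequences_tensor:
  fixes \<tau> :: "(nat \<Rightarrow>\<^sub>C complex) \<Rightarrow> 'h::complex_hilbert_space bop \<Rightarrow> 't::cstar_algebra"
    and \<theta> :: "(nat \<Rightarrow>\<^sub>C 'h bop) \<Rightarrow> 't"
  assumes sep: "separable_space (euclidean :: 'h topology)"
    and inf: "\<not> (\<exists>B::'h set. finite B \<and> cspan B = UNIV)"
    and tensor: "cstar_tensor_product \<tau>"
    and \<theta>: "jordan_homomorphism \<theta>" and "bij \<theta>"
  shows False
proof -
  obtain ev :: "'t \<Rightarrow> 'h bop" where ev_lin: "clinear ev"
    and ev_mult: "\<And>s t. ev (s * t) = ev s * ev t"
    and ev_unit: "ev (\<tau> (const_bcontfun 1) bop_id) = bop_id"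
    and ev_zero: "\<And>t. eventually (\<lambda>n. slot \<tau> n * t = 0) sequentially \<Longrightarrow> ev t = 0"
    using exists_evaluation_at_infinity[OF tensor] by blast
  define \<eta> where "\<eta> = inv \<theta>"
  have \<eta>: "jordan_homomorphism \<eta>" unfolding \<eta>_def by (rule jordan_inverse[OF \<theta> \<open>bij \<theta>\<close>])
  have "surj \<eta>" unfolding \<eta>_def using \<open>bij \<theta>\<close> by (simp add: bij_is_surj bij_imp_bij_inv)
  have \<theta>\<eta>: "\<theta> (\<eta> t) = t" for t
    unfolding \<eta>_def using \<open>bij \<theta>\<close> by (simp add: bij_is_surj surj_f_inv_f)
  note \<theta>_add = clinear_add[OF jordan_clinear[OF \<theta>]]
  define e where "e = \<tau> (const_bcontfun 1) bop_id"
  have "\<theta> (const_bcontfun bop_id) = e"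
  proof -
    have "const_bcontfun bop_id * x = x" "x * const_bcontfun bop_id = x" for x :: "nat \<Rightarrow>\<^sub>C 'h bop"
      by (auto intro: bcontfun_eqI)
    then have "\<theta> (const_bcontfun bop_id * \<eta> e + \<eta> e * const_bcontfun bop_id) = e + e"
      by (simp add: \<theta>_add \<theta>\<eta>)
    then have "\<theta> (const_bcontfun bop_id) + \<theta> (const_bcontfun bop_id) = e + e"
      unfolding jordan_anticommutator[OF \<theta>] by (simp add: \<theta>\<eta> e_def tensor_unit[OF tensor])
    then show ?thesis by (simp only: double_eq_iff)
  qed
  then have unit: "ev (\<theta> (const_bcontfun bop_id)) = bop_id" by (simp add: ev_unit e_def)
  define g where "g = (\<lambda>n. \<eta> (slot \<tau> n))"
  have g_central: "g n * x = x * g n" for n x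
    unfolding g_def
  proof (rule jordan_surj_central_idempotent[OF \<eta> \<open>surj \<eta>\<close>])
    show "slot \<tau> n * slot \<tau> n = slot \<tau> n" by (simp add: slot_orthogonal[OF tensor])
    show "slot \<tau> n * t = t * slot \<tau> n" for t by (rule slot_central[OF tensor])
  qed
  have g_orth: "g m * g n = 0" if "m \<noteq> n" for m n
  proof (rule anticommuting_idempotents_orthogonal)
    show "g m * g m = g m"
      unfolding g_def jordan_square[OF \<eta>, symmetric] by (simp add: slot_orthogonal[OF tensor])
    show "g m * g n + g n * g m = 0"
      unfolding g_def jordan_anticommutator[OF \<eta>, symmetric]
      using that by (simp add: slot_orthogonal[OF tensor] clinear_zero[OF jordan_clinear[OF \<eta>]])
  qed
  have zero: "ev (\<theta> x) = 0" if x: "eventually (\<lambda>n. apply_bcontfun x n = 0) sequentially" for x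
  proof (rule ev_zero)
    obtain N where N: "\<And>k. k \<ge> N \<Longrightarrow> apply_bcontfun x k = 0"
      using x unfolding eventually_sequentially by blast
    have "eventually (\<lambda>n. \<forall>k\<in>{..<N}. apply_bcontfun (g n) k = 0) sequentially"
      by (intro eventually_ball_finite ballI
          eventually_orthogonal_central_vanish[OF g_central g_orth]) simp_all
    then show "eventually (\<lambda>n. slot \<tau> n * \<theta> x = 0) sequentially"
    proof (rule eventually_mono)
      fix n assume n: "\<forall>k\<in>{..<N}. apply_bcontfun (g n) k = 0"
      have "g n * x = 0"
      proof (rule bcontfun_eqI)
        fix k
        show "apply_bcontfun (g n * x) k = apply_bcontfun 0 k"
          using n N[of k] by (cases "k < N") simp_all
      qed
      then have "g n * x + x * g n = 0" using g_central[of n x] by simp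
      then have "\<theta> (g n * x + x * g n) = 0" by (simp only: clinear_zero[OF jordan_clinear[OF \<theta>]])
      then have "slot \<tau> n * \<theta> x + \<theta> x * slot \<tau> n = 0"
        by (simp only: jordan_anticommutator[OF \<theta>] g_def \<theta>\<eta>)
      then have "slot \<tau> n * \<theta> x + slot \<tau> n * \<theta> x = 0 + 0"
        by (simp only: slot_central[OF tensor, of n "\<theta> x"] add_0)
      then show "slot \<tau> n * \<theta> x = 0" by (simp only: double_eq_iff)
    qed
  qed
  have "jordan_homomorphism (\<lambda>x. ev (\<theta> x))"
    unfolding jordan_homomorphism_def
    by (auto intro!: clinearI simp: jordan_square[OF \<theta>] ev_mult \<theta>_add clinear_add[OF ev_lin]
        clinear_scaleC[OF ev_lin] clinear_scaleC[OF jordan_clinear[OF \<theta>]])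
  from no_unital_jordan_homomorphism_vanishing_on_finite_sequences[OF sep inf this unit zero]
  show False .
qed

theorem corollary2:
  fixes \<tau> :: "(nat \<Rightarrow>\<^sub>C complex) \<Rightarrow> 'h::complex_hilbert_space bop \<Rightarrow> 't::cstar_algebra"
  assumes separable: "separable_space (euclidean :: 'h topology)"
    and infinite_dimensional: "\<not> (\<exists>B::'h set. finite B \<and> cspan B = UNIV)"
    and tensor: "cstar_tensor_product \<tau>"
  shows "\<not> (\<exists>\<phi> :: 't \<Rightarrow> (nat \<Rightarrow>\<^sub>C 'h bop). bij \<phi> \<and> jordan_homomorphism \<phi>)
       \<and> \<not> (\<exists>\<psi> :: (nat \<Rightarrow>\<^sub>C 'h bop) \<Rightarrow> 't. bij \<psi> \<and> jordan_homomorphism \<psi>)"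
  using no_jordan_isomorphism_bounded_sequences_tensor[OF separable infinite_dimensional tensor]
    jordan_inverse bij_imp_bij_inv by blast

end
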